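(* Let $f_1,\dots,f_k$ be functions $f_i:\{0,1\}^n\times\{0,1\}^n\to\{0,1\}$, each evaluated on parts of Alice's and Bob's inputs. Then (1) $GH(\bigvee_i f_i)=O(\sum_i GH(f_i))$; (2) $GH(\bigwedge_i f_i)=O(\sum_i GH(f_i))$; (3) $GH(\bigoplus_i f_i)=O(\sum_i GH(f_i))$; (4) $GH(MAJ(f_1,\dots,f_k))=O(\sum_i GH(f_i)\cdot\log^3 k)$, where $MAJ(z_1,\dots,z_k)=1$ iff $\sum_i z_i\ge k/2$.
   Context: Garden-hose model: Alice holds $x$, Bob holds $y$. A garden-hose protocol of size $s$ consists of a set $V$ of $s$ vertices (pipes) and an extra vertex $t$ (the tap), together with an assignment of a matching $E_A(x)$ on $V\cup\{t\}$ to every input $x$ of Alice and a matching $E_B(y)$ on $V$ to every input $y$ of Bob. In the graph $(V\cup\{t\},E_A(x)\cup E_B(y))$ every vertex has degree at most 2, so there is a unique maximal path starting at $t$; the output on $(x,y)$ is the parity of the number of edges of this path. The protocol computes a function if the output equals the function value for all inputs. $GH(h)$ is the minimum size of a garden-hose protocol computing $h$. Compositions such as $\bigvee_i f_i$ denote the function mapping the inputs to $\bigvee_i f_i(\cdot)$. *)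

theory Defs
  imports Complex_Main
begin

definition is_matching :: "'v set \<Rightarrow> 'v set set \<Rightarrow> bool" where
  "is_matching W E \<longleftrightarrow> (\<forall>e\<in>E. e \<subseteq> W \<and> card e = 2) \<and> pairwise disjnt E"

definition path_from :: "'v set set \<Rightarrow> 'v \<Rightarrow> 'v list \<Rightarrow> bool" where
  "path_from E t ws \<longleftrightarrow>
     ws \<noteq> [] \<and> hd ws = t \<and> distinct ws \<and> successively (\<lambda>u v. {u, v} \<in> E) ws"

definition maximal_path_from :: "'v set set \<Rightarrow> 'v \<Rightarrow> 'v list \<Rightarrow> bool" where
  "maximal_path_from E t ws \<longleftrightarrow> path_from E t ws \<and> (\<forall>v. \<not> path_from E t (ws @ [v]))"

record ('x, 'y, 'v) garden_hose =
  pipes :: "'v set"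
  tap :: 'v
  alice :: "'x \<Rightarrow> 'v set set"
  bob :: "'y \<Rightarrow> 'v set set"

definition gh_protocol :: "'x set \<Rightarrow> 'y set \<Rightarrow> ('x, 'y, 'v) garden_hose \<Rightarrow> bool" where
  "gh_protocol X Y P \<longleftrightarrow>
     finite (pipes P) \<and> tap P \<notin> pipes P \<and>
     (\<forall>x\<in>X. is_matching (insert (tap P) (pipes P)) (alice P x)) \<and>
     (\<forall>y\<in>Y. is_matching (pipes P) (bob P y))"

text \<open>A path given by its vertex list \<open>ws\<close> has \<open>length ws - 1\<close> edges.\<close>

definition gh_output :: "('x, 'y, 'v) garden_hose \<Rightarrow> 'x \<Rightarrow> 'y \<Rightarrow> bool" where
  "gh_output P x y =
     odd (length (THE ws. maximal_path_from (alice P x \<union> bob P y) (tap P) ws) - 1)"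

definition gh_computes ::
    "'x set \<Rightarrow> 'y set \<Rightarrow> ('x, 'y, 'v) garden_hose \<Rightarrow> ('x \<Rightarrow> 'y \<Rightarrow> bool) \<Rightarrow> bool" where
  "gh_computes X Y P h \<longleftrightarrow> (\<forall>x\<in>X. \<forall>y\<in>Y. gh_output P x y = h x y)"

text \<open>Taking natural numbers as vertices is no restriction, since protocols are finite.\<close>

definition GH :: "'x set \<Rightarrow> 'y set \<Rightarrow> ('x \<Rightarrow> 'y \<Rightarrow> bool) \<Rightarrow> nat" where
  "GH X Y h = (LEAST s. \<exists>P :: ('x, 'y, nat) garden_hose.
     gh_protocol X Y P \<and> card (pipes P) = s \<and> gh_computes X Y P h)"

definition bitstrings :: "nat \<Rightarrow> bool list set" where
  "bitstrings n = {x. length x = n}"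

text \<open>Alice holds \<open>a\<close> bits and Bob \<open>b\<close> bits; the \<open>i\<close>-th function reads the \<open>n\<close> bits of Alice
  at the positions in \<open>A i\<close> and the \<open>n\<close> bits of Bob at the positions in \<open>B i\<close>. The parts
  belonging to different indices may be disjoint, overlap or coincide.\<close>

definition input_parts ::
    "nat \<Rightarrow> nat \<Rightarrow> nat \<Rightarrow> nat \<Rightarrow> (nat \<Rightarrow> nat set) \<Rightarrow> (nat \<Rightarrow> nat set) \<Rightarrow> bool" where
  "input_parts k n a b A B \<longleftrightarrow>
     (\<forall>i\<in>{1..k}. A i \<subseteq> {..<a} \<and> card (A i) = n \<and> B i \<subseteq> {..<b} \<and> card (B i) = n)"

definition on_parts ::
    "(nat \<Rightarrow> bool list \<Rightarrow> bool list \<Rightarrow> bool) \<Rightarrow> (nat \<Rightarrow> nat set) \<Rightarrow> (nat \<Rightarrow> nat set) \<Rightarrow>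
     nat \<Rightarrow> bool list \<Rightarrow> bool list \<Rightarrow> bool" where
  "on_parts f A B i x y = f i (nths x (A i)) (nths y (B i))"

definition OR :: "nat \<Rightarrow> (nat \<Rightarrow> bool) \<Rightarrow> bool" where
  "OR k z \<longleftrightarrow> (\<exists>i\<in>{1..k}. z i)"

definition AND :: "nat \<Rightarrow> (nat \<Rightarrow> bool) \<Rightarrow> bool" where
  "AND k z \<longleftrightarrow> (\<forall>i\<in>{1..k}. z i)"

definition XOR :: "nat \<Rightarrow> (nat \<Rightarrow> bool) \<Rightarrow> bool" where
  "XOR k z \<longleftrightarrow> odd (\<Sum>i=1..k. of_bool (z i) :: nat)"

definition MAJ :: "nat \<Rightarrow> (nat \<Rightarrow> bool) \<Rightarrow> bool" where
  "MAJ k z \<longleftrightarrow> (\<Sum>i=1..k. of_bool (z i) :: real) \<ge> real k / 2"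


text \<open>The next two facts show that the definite description in \<^const>\<open>gh_output\<close> and the minimum
  in \<^const>\<open>GH\<close> are proper.\<close>

lemma matching_edge_unique:
  assumes "is_matching W E" "{u, v} \<in> E" "{u, w} \<in> E"
  shows "v = w"
proof -
  have "\<not> disjnt {u, v} {u, w}" by (simp add: disjnt_def)
  then have "{u, v} = {u, w}"
    using assms by (meson is_matching_def pairwiseD)
  then show ?thesis by (auto simp: doubleton_eq_iff)
qed

lemma path_from_edge:
  assumes "path_from E t ws" "Suc i < length ws"
  shows "{ws ! i, ws ! Suc i} \<in> E"
  using assms by (auto simp: path_from_def successively_conv_nth)

lemma path_from_nth_unique:
  assumes A: "is_matching (insert t V) EA" and B: "is_matching V EB" and t: "t \<notin> V"
    and p: "path_from (EA \<union> EB) t ws" and q: "path_from (EA \<union> EB) t ws'"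
  shows "i < length ws \<Longrightarrow> i < length ws' \<Longrightarrow> ws ! i = ws' ! i"
proof (induction i rule: less_induct)
  case (less i)
  have t0: "ws ! 0 = t" "ws' ! 0 = t"
    using p q by (auto simp: path_from_def hd_conv_nth)
  show ?case
  proof (cases i)
    case 0
    then show ?thesis using t0 by simp
  next
    case (Suc j)
    have eq: "ws ! j = ws' ! j" using less Suc by simp
    have e: "{ws ! j, ws ! i} \<in> EA \<union> EB" "{ws ! j, ws' ! i} \<in> EA \<union> EB"
      using path_from_edge[OF p, of j] path_from_edge[OF q, of j] less Suc eq by auto
    show ?thesis
    proof (cases j)
      case 0
      have "{ws ! j, v} \<notin> EB" for v
        using B t t0 0 by (auto simp: is_matching_def)
      then show ?thesis using e matching_edge_unique[OF A] by blast
    next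
      case (Suc l)
      have eql: "ws ! l = ws' ! l" using less Suc \<open>i = Suc j\<close> by simp
      have f: "{ws ! j, ws ! l} \<in> EA \<union> EB"
        using path_from_edge[OF p, of l] less Suc \<open>i = Suc j\<close> by (auto simp: insert_commute)
      have "ws ! l \<noteq> ws ! i" "ws' ! l \<noteq> ws' ! i"
        using p q less.prems Suc \<open>i = Suc j\<close> nth_eq_iff_index_eq[of ws l i]
          nth_eq_iff_index_eq[of ws' l i]
        by (simp_all add: path_from_def)
      then show ?thesis
        using e f eql matching_edge_unique[OF A] matching_edge_unique[OF B] by (metis Un_iff)
    qed
  qed
qed

lemma path_from_take:
  assumes "path_from E t ws" "0 < n"
  shows "path_from E t (take n ws)"
  using assms by (auto simp: path_from_def successively_conv_nth hd_take)

lemma maximal_path_length_le: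
  assumes "is_matching (insert t V) EA" "is_matching V EB" "t \<notin> V"
    and p: "path_from (EA \<union> EB) t ws" and q: "maximal_path_from (EA \<union> EB) t ws'"
  shows "length ws \<le> length ws'"
proof (rule ccontr)
  assume "\<not> ?thesis"
  then have l: "length ws' < length ws" by simp
  have q': "path_from (EA \<union> EB) t ws'" using q by (simp add: maximal_path_from_def)
  have "take (length ws') ws = ws'"
    using path_from_nth_unique[OF assms(1-3) p q'] l by (intro nth_equalityI) auto
  then have "take (Suc (length ws')) ws = ws' @ [ws ! length ws']"
    using l by (simp add: take_Suc_conv_app_nth)
  then show False
    using path_from_take[OF p, of "Suc (length ws')"] q by (auto simp: maximal_path_from_def)
qed

lemma path_from_vertices:
  assumes A: "is_matching (insert t V) EA" and B: "is_matching V EB"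
    and p: "path_from (EA \<union> EB) t ws"
  shows "set ws \<subseteq> insert t V"
proof
  fix v assume "v \<in> set ws"
  then obtain i where i: "i < length ws" "v = ws ! i" by (auto simp: in_set_conv_nth)
  show "v \<in> insert t V"
  proof (cases i)
    case 0
    then show ?thesis using i p by (auto simp: path_from_def hd_conv_nth)
  next
    case (Suc j)
    then have "{ws ! j, v} \<in> EA \<union> EB" using path_from_edge[OF p, of j] i by simp
    then show ?thesis using A B by (auto simp: is_matching_def)
  qed
qed

theorem ex1_maximal_path:
  assumes P: "gh_protocol X Y P" and "x \<in> X" "y \<in> Y"
  shows "\<exists>!ws. maximal_path_from (alice P x \<union> bob P y) (tap P) ws"
proof -
  let ?E = "alice P x \<union> bob P y" and ?t = "tap P"
  have A: "is_matching (insert ?t (pipes P)) (alice P x)" and B: "is_matching (pipes P) (bob P y)"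
    and t: "?t \<notin> pipes P" and fin: "finite (insert ?t (pipes P))"
    using assms by (auto simp: gh_protocol_def)
  have bound: "length ws \<le> card (insert ?t (pipes P))" if "path_from ?E ?t ws" for ws
  proof -
    have "length ws = card (set ws)"
      using that by (simp add: path_from_def distinct_card)
    then show ?thesis using card_mono[OF fin path_from_vertices[OF A B that]] by simp
  qed
  have "path_from ?E ?t [?t]" by (simp add: path_from_def)
  then obtain ws where ws: "path_from ?E ?t ws"
      "\<And>us. path_from ?E ?t us \<Longrightarrow> length us \<le> length ws"
    using ex_has_greatest_nat[of "path_from ?E ?t" "[?t]" length "Suc (card (insert ?t (pipes P)))"]
      bound by (metis less_Suc_eq_le)
  show ?thesis
  proof (rule ex1I)
    show "maximal_path_from ?E ?t ws"
      using ws(1) ws(2)[of "ws @ [v]" for v] by (fastforce simp: maximal_path_from_def)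
  next
    fix us assume us: "maximal_path_from ?E ?t us"
    then have pu: "path_from ?E ?t us" by (simp add: maximal_path_from_def)
    have "length us = length ws"
      using maximal_path_length_le[OF A B t ws(1) us] ws(2)[OF pu] by simp
    then show "us = ws"
      using path_from_nth_unique[OF A B t pu ws(1)] by (intro nth_equalityI) auto
  qed
qed

lemma gh_output_eq:
  assumes "gh_protocol X Y P" "x \<in> X" "y \<in> Y"
    and "maximal_path_from (alice P x \<union> bob P y) (tap P) ws"
  shows "gh_output P x y = odd (length ws - 1)"
  using the1_equality[OF ex1_maximal_path[OF assms(1-3)] assms(4)] by (simp add: gh_output_def)

theorem ex_protocol:
  assumes "finite X"
  shows "\<exists>P :: ('x, 'y, nat) garden_hose. gh_protocol X Y P \<and> gh_computes X Y P h"
proof -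
  obtain c :: "'x \<Rightarrow> nat" where c: "inj_on c X"
    using finite_imp_inj_to_nat_seg[OF assms] by blast
  define p where "p x = 2 * c x + 1" for x
  define q where "q x = 2 * c x + 2" for x
  have pq: "p x \<noteq> q x'" "0 \<noteq> p x" "0 \<noteq> q x" for x x'
    unfolding p_def q_def by presburger+
  have inj: "p x = p x' \<longleftrightarrow> x = x'" "q x = q x' \<longleftrightarrow> x = x'" if "x \<in> X" "x' \<in> X" for x x'
    using inj_onD[OF c] that by (auto simp: p_def q_def)
  define P :: "('x, 'y, nat) garden_hose" where
    "P = \<lparr>pipes = p ` X \<union> q ` X, tap = 0, alice = (\<lambda>x. {{0, p x}}),
          bob = (\<lambda>y. {{p x, q x} | x. x \<in> X \<and> \<not> h x y})\<rparr>"
  have prot: "gh_protocol X Y P"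
    using assms inj
    by (auto simp: pq pq[symmetric] gh_protocol_def P_def is_matching_def pairwise_def disjnt_def card_insert_if)
  have "gh_output P x y = h x y" if xy: "x \<in> X" "y \<in> Y" for x y
  proof (cases "h x y")
    case True
    have "maximal_path_from (alice P x \<union> bob P y) (tap P) [0, p x]"
      using inj xy True
      by (auto simp: pq pq[symmetric] maximal_path_from_def path_from_def P_def doubleton_eq_iff)
    from gh_output_eq[OF prot xy this] True show ?thesis by simp
  next
    case False
    have "maximal_path_from (alice P x \<union> bob P y) (tap P) [0, p x, q x]"
      using inj xy False
      by (auto simp: pq pq[symmetric] maximal_path_from_def path_from_def P_def doubleton_eq_iff)
    from gh_output_eq[OF prot xy this] False show ?thesis by simp
  qed
  then show ?thesis using prot by (auto simp: gh_computes_def)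
qed

end

theory Submission
  imports Defs "HOL-Library.Countable" "HOL-Combinatorics.Permutations"
begin

text \<open>A protocol for \<open>f\<close> is turned into a switch with one input pipe and two output pipes, of which
  exactly the one belonging to the value of \<open>f\<close> is reached; running the path of the protocol
  backwards in a further copy brings the water to a pipe that does not depend on where the path ended.
  Since switches can be passed in both directions, networks of switches simulate reversible
  branching programs over the variables \<open>f_i\<close> at constant cost per state and queried variable.
  Disjunction, conjunction and parity have such programs of width 2 that read every variable once.

  For majority, let \<open>D\<close> be the number of true variables minus the threshold and suppose that
  \<open>|D| \<le> B\<close>. Following Sinha and Thathachar, \<open>a D mod 1\<close> is computed up to a small error for some
  \<open>a\<close> of order \<open>1 / B\<close> which is, modulo 1, a sum of fractions with denominators \<open>O(log k)\<close>: one
  denominator after the other, the state is a point of a cyclic grid of \<open>O(log k)\<close> points that every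
  true variable rotates. The result either reveals the sign of \<open>D\<close> or shows \<open>|D| \<le> B / 2\<close>. In the
  latter case the computation is undone and restarted with \<open>B / 2\<close>. With \<open>O(log k)\<close> values of \<open>B\<close>,
  \<open>O(log k)\<close> denominators and \<open>O(log k)\<close> states this costs \<open>O(log^3 k)\<close> switches per
  variable.\<close>

section \<open>Alternating walks\<close>

text \<open>Matchings are handled as involutions whose fixed points are the unmatched vertices.\<close>

definition mate :: "'v set set \<Rightarrow> 'v \<Rightarrow> 'v" where
  "mate E v = (if \<exists>w. {v, w} \<in> E then THE w. {v, w} \<in> E else v)"

definition matching_map :: "'v set \<Rightarrow> ('v \<Rightarrow> 'v) \<Rightarrow> bool" where
  "matching_map W f \<longleftrightarrow> (\<forall>v. f (f v) = v) \<and> (\<forall>v. v \<notin> W \<longrightarrow> f v = v)"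

definition edges_of :: "('v \<Rightarrow> 'v) \<Rightarrow> 'v set set" where
  "edges_of f = {{v, f v} | v. f v \<noteq> v}"

lemma mate_eq:
  assumes "is_matching W E" "{v, w} \<in> E"
  shows "mate E v = w"
  unfolding mate_def using assms matching_edge_unique[OF assms(1)] by (auto intro!: the_equality)

lemma mate_fixed:
  assumes "\<And>w. {v, w} \<notin> E"
  shows "mate E v = v"
  using assms by (simp add: mate_def)

lemma edge_mate:
  assumes "is_matching W E" "mate E v \<noteq> v"
  shows "{v, mate E v} \<in> E"
  using assms mate_eq by (metis mate_def)

lemma matching_map_mate:
  assumes "is_matching W E"
  shows "matching_map W (mate E)"
  unfolding matching_map_def
proof (intro conjI allI impI)
  fix v
  show "mate E (mate E v) = v"
    using edge_mate[OF assms, of v] mate_eq[OF assms, of "mate E v" v] by (metis insert_commute)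
  show "mate E v = v" if "v \<notin> W"
    using that edge_mate[OF assms, of v] assms unfolding is_matching_def by blast
qed

lemma edges_of_iff:
  assumes "matching_map W f"
  shows "{u, v} \<in> edges_of f \<longleftrightarrow> f u = v \<and> u \<noteq> v"
  using assms by (auto simp: edges_of_def matching_map_def doubleton_eq_iff)

lemma is_matching_edges_of:
  assumes "matching_map W f"
  shows "is_matching W (edges_of f)"
  unfolding is_matching_def
proof (intro conjI ballI)
  fix e assume "e \<in> edges_of f"
  then show "e \<subseteq> W" "card e = 2"
    using assms by (auto simp: edges_of_def matching_map_def card_insert_if)
next
  show "pairwise disjnt (edges_of f)"
  proof (rule pairwiseI)
    fix e e' assume "e \<in> edges_of f" "e' \<in> edges_of f" "e \<noteq> e'"
    then obtain u v where "e = {u, f u}" "e' = {v, f v}" by (auto simp: edges_of_def)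
    moreover from this have "u \<noteq> v" "u \<noteq> f v"
      using \<open>e \<noteq> e'\<close> assms by (auto simp: matching_map_def)
    moreover have "f u \<noteq> f v" "f u \<noteq> v" using \<open>u \<noteq> v\<close> \<open>u \<noteq> f v\<close> assms
      by (metis matching_map_def)+
    ultimately show "disjnt e e'" by (auto simp: disjnt_def)
  qed
qed

section \<open>Walks that alternate between two involutions\<close>

inductive walk :: "('v \<Rightarrow> 'v) \<Rightarrow> ('v \<Rightarrow> 'v) \<Rightarrow> 'v \<Rightarrow> nat \<Rightarrow> 'v \<Rightarrow> bool" where
  walk_0: "walk a b u 0 u"
| walk_Suc: "a u \<noteq> u \<Longrightarrow> walk b a (a u) n v \<Longrightarrow> walk a b u (Suc n) v"

lemma walk_append:
  assumes "walk a b u m v"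
    and "even m \<Longrightarrow> walk a b v n w" "odd m \<Longrightarrow> walk b a v n w"
  shows "walk a b u (m + n) w"
  using assms by (induction rule: walk.induct) (auto intro: walk_Suc)

lemma walk_1: "a u \<noteq> u \<Longrightarrow> walk a b u 1 (a u)"
  using walk_Suc[OF _ walk_0] by simp

text \<open>The reversed walk starts with the map that made the last step: the second map if the
  length is even, the first one if it is odd.\<close>

lemma walk_rev:
  assumes "walk a b u n v" "\<And>w. a (a w) = w" "\<And>w. b (b w) = w"
  shows "if even n then walk b a v n u else walk a b v n u"
  using assms
proof (induction rule: walk.induct)
  case (walk_Suc a u b n v)
  have w: "walk a b (a u) 1 u" using walk_1[of a "a u" b] walk_Suc by simp
  show ?case
  proof (cases "even n")
    case True
    then have "walk a b v n (a u)" using walk_Suc by simp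
    then have "walk a b v (n + 1) u" by (rule walk_append) (use w True in auto)
    then show ?thesis using True by simp
  next
    case False
    then have "walk b a v n (a u)" using walk_Suc by simp
    then have "walk b a v (n + 1) u" by (rule walk_append) (use w False in auto)
    then show ?thesis using False by simp
  qed
qed (simp add: walk_0)

lemma walk_map:
  assumes "walk a b u n v" "inj p"
    and "\<And>u. a u \<noteq> u \<Longrightarrow> a' (p u) = p (a u)" "\<And>u. b u \<noteq> u \<Longrightarrow> b' (p u) = p (b u)"
  shows "walk a' b' (p u) n (p v)"
  using assms
proof (induction arbitrary: a' b' rule: walk.induct)
  case (walk_Suc a u b n v)
  then have "walk b' a' (p (a u)) n (p v)" by blast
  then show ?case using walk_Suc by (metis walk.walk_Suc injD)
qed (rule walk_0)

lemma walk_seq: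
  assumes "\<And>m. m < n \<Longrightarrow> f (Suc m) = (if even m then a else b) (f m)"
    and "\<And>m. m < n \<Longrightarrow> f (Suc m) \<noteq> f m"
  shows "walk a b (f 0) n (f n)"
  using assms
proof (induction n)
  case (Suc n)
  then have w: "walk a b (f 0) n (f n)" by simp
  have "walk a b (f 0) (n + 1) (f (Suc n))"
    by (rule walk_append[OF w]) (use Suc.prems(1,2)[of n] walk_1 in auto)
  then show ?case by simp
qed (simp add: walk_0)

lemma walk_seqE:
  assumes "walk a b u n v"
  obtains f where "f 0 = u" "f n = v" "\<And>m. m < n \<Longrightarrow> f (Suc m) = (if even m then a else b) (f m)"
    and "\<And>m. m < n \<Longrightarrow> f (Suc m) \<noteq> f m"
proof -
  have "\<exists>f. f 0 = u \<and> f n = v \<and> (\<forall>m<n. f (Suc m) = (if even m then a else b) (f m) \<and> f (Suc m) \<noteq> f m)"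
    using assms
  proof (induction rule: walk.induct)
    case (walk_Suc a u b n v)
    then obtain f where f: "f 0 = a u" "f n = v"
      "\<forall>m<n. f (Suc m) = (if even m then b else a) (f m) \<and> f (Suc m) \<noteq> f m" by blast
    show ?case
      by (rule exI[of _ "case_nat u f"])
        (use f walk_Suc(1) in \<open>auto split: nat.splits simp: less_Suc_eq_0_disj\<close>)
  qed auto
  then show thesis using that by blast
qed

text \<open>If \<open>f i = f j\<close> with \<open>j - i\<close> even, both vertices were entered
  by the same map, so the equality moves down to the predecessors until it reaches the start, where
  \<open>b\<close> would have to move a vertex that it fixes. If \<open>j - i\<close> is odd, the
  equality moves inwards from both ends until it relates two neighbours. Hence the measure is
  \<open>i\<close> in the first case and \<open>j - i\<close> in the second.\<close>

lemma walk_seq_inj: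
  assumes a: "\<And>w. a (a w) = w" and b: "\<And>w. b (b w) = w" and t: "b (f 0) = f 0"
    and f: "\<And>m. m < n \<Longrightarrow> f (Suc m) = (if even m then a else b) (f m)"
    and ne: "\<And>m. m < n \<Longrightarrow> f (Suc m) \<noteq> f m"
  shows "inj_on f {..n}"
proof -
  have prev: "f m = (if even m then a else b) (f (Suc m))" if "m < n" for m
    using f[OF that] a b by auto
  have neq: "f i \<noteq> f j" if "i < j" "j \<le> n" for i j
    using that
  proof (induction "if even (j - i) then i else j - i" arbitrary: i j rule: less_induct)
    case less
    show ?case
    proof
      assume eq: "f i = f j"
      obtain j' where j: "j = Suc j'" using less.prems by (cases j) auto
      show False
      proof (cases "even (j - i)")
        case True
        show False
        proof (cases i)
          case 0
          then have "odd j'" "j' < n" using True less.prems j by auto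
          then have "f j' = b (f 0)" using prev[of j'] eq 0 j by simp
          then show False using t ne[of j'] eq 0 j \<open>j' < n\<close> by simp
        next
          case (Suc i')
          have "even i' \<longleftrightarrow> even j'" using True Suc j less.prems by auto
          moreover have "i' < n" "j' < n" using less.prems Suc j by auto
          ultimately have "f i' = f j'" using prev[of i'] prev[of j'] eq Suc j by simp
          moreover have "f i' \<noteq> f j'"
            by (rule less.hyps) (use less.prems Suc j True in auto)
          ultimately show False by simp
        qed
      next
        case False
        show False
        proof (cases "j' = i")
          case True
          then show False using ne[of i] eq less.prems j by simp
        next
          case neq: False
          have lt: "Suc i < j'" using neq False less.prems j
            by (metis Suc_diff_le Suc_lessI cancel_comm_monoid_add_class.diff_cancel even_Suc even_zero less_Suc_eq_le nat_less_le)
          have "even i \<longleftrightarrow> even j'" using False j less.prems by auto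
          then have "f (Suc i) = f j'" using f[of i] prev[of j'] eq less.prems j by simp
          moreover have "f (Suc i) \<noteq> f j'"
            by (rule less.hyps) (use less.prems lt j False in auto)
          ultimately show False by simp
        qed
      qed
    qed
  qed
  show ?thesis
    by (rule inj_onI) (metis atMost_iff linorder_neqE_nat neq)
qed

section \<open>From walks to protocols\<close>

definition outputs :: "('v \<Rightarrow> 'v) \<Rightarrow> ('v \<Rightarrow> 'v) \<Rightarrow> 'v \<Rightarrow> bool \<Rightarrow> bool" where
  "outputs a b t r \<longleftrightarrow> (\<exists>n v. walk a b t n v \<and> (if even n then a else b) v = v \<and> odd n = r)"

lemma walk_maximal_path:
  assumes a: "matching_map (insert t W) a" and b: "matching_map W b" and t: "t \<notin> W"
    and w: "walk a b t n v" and fixed: "(if even n then a else b) v = v"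
  shows "\<exists>ws. maximal_path_from (edges_of a \<union> edges_of b) t ws \<and> length ws = Suc n"
proof -
  obtain f where f: "f 0 = t" "f n = v"
      "\<And>m. m < n \<Longrightarrow> f (Suc m) = (if even m then a else b) (f m)"
      "\<And>m. m < n \<Longrightarrow> f (Suc m) \<noteq> f m"
    using walk_seqE[OF w] by metis
  have inv: "a (a u) = u" "b (b u) = u" for u
    using a b by (auto simp: matching_map_def)
  have bt: "b t = t" using b t by (auto simp: matching_map_def)
  have inj: "inj_on f {..n}"
    by (rule walk_seq_inj[of a b]) (use inv bt f in auto)
  define ws where "ws = map f [0..<Suc n]"
  have nth: "ws ! i = f i" if "i \<le> n" for i
    using that unfolding ws_def by (subst nth_map) (auto simp del: upt_Suc)
  have len: "length ws = Suc n" by (simp add: ws_def)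
  have e: "{u, w} \<in> edges_of a \<union> edges_of b \<longleftrightarrow> (a u = w \<or> b u = w) \<and> u \<noteq> w" for u w
    using edges_of_iff[OF a] edges_of_iff[OF b] by auto
  have "path_from (edges_of a \<union> edges_of b) t ws"
    unfolding path_from_def successively_conv_nth
  proof (intro conjI allI impI)
    show "ws \<noteq> []" using len by auto
    then show "hd ws = t" using nth[of 0] f by (simp add: hd_conv_nth)
    have "set [0..<Suc n] = {..n}" by auto
    then show "distinct ws" unfolding ws_def distinct_map using inj distinct_upt by metis
    fix i assume "Suc i < length ws"
    then show "{ws ! i, ws ! Suc i} \<in> edges_of a \<union> edges_of b"
      using f(3)[of i] f(4)[of i] unfolding e by (auto simp: nth len)
  qed
  moreover have "\<not> path_from (edges_of a \<union> edges_of b) t (ws @ [w])" for w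
  proof
    assume p: "path_from (edges_of a \<union> edges_of b) t (ws @ [w])"
    then have w: "w \<noteq> f i" if "i \<le> n" for i
      using that nth_mem[of i ws] len nth by (auto simp: path_from_def)
    have "{f n, w} \<in> edges_of a \<union> edges_of b"
      using path_from_edge[OF p, of n] len nth by (simp add: nth_append)
    then have *: "a v = w \<or> b v = w" using e f by auto
    \<comment> \<open>The map whose turn it is fixes \<open>v\<close>; the other one leads back to
      the preceding vertex or, if \<open>n = 0\<close>, is \<open>b\<close> and fixes the
      tap.\<close>
    show False
    proof (cases n)
      case 0
      then show False using * fixed bt f w[of 0] by auto
    next
      case (Suc m)
      then show False using * fixed f(2) f(3)[of m] w[of m] w[of n] inv by (auto split: if_splits)
    qed
  qed
  ultimately show ?thesis using len by (auto simp: maximal_path_from_def)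
qed

lemma GH_le_nat:
  fixes a :: "'x \<Rightarrow> nat \<Rightarrow> nat"
  assumes W: "finite W" "t \<notin> W"
    and a: "\<And>x. x \<in> X \<Longrightarrow> matching_map (insert t W) (a x)"
    and b: "\<And>y. y \<in> Y \<Longrightarrow> matching_map W (b y)"
    and out: "\<And>x y. x \<in> X \<Longrightarrow> y \<in> Y \<Longrightarrow> outputs (a x) (b y) t (h x y)"
  shows "GH X Y h \<le> card W"
proof -
  define P where "P = \<lparr>pipes = W, tap = t, alice = edges_of \<circ> a, bob = edges_of \<circ> b\<rparr>"
  have P: "gh_protocol X Y P"
    using assms by (auto simp: gh_protocol_def P_def intro!: is_matching_edges_of)
  have "gh_output P x y = h x y" if xy: "x \<in> X" "y \<in> Y" for x y
  proof -
    obtain n v where n: "walk (a x) (b y) t n v" "(if even n then a x else b y) v = v" "odd n = h x y"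
      using out[OF xy] by (auto simp: outputs_def)
    obtain ws where "maximal_path_from (edges_of (a x) \<union> edges_of (b y)) t ws" "length ws = Suc n"
      using walk_maximal_path[OF a[OF xy(1)] b[OF xy(2)] W(2) n(1,2)] by auto
    then show ?thesis using gh_output_eq[OF P xy, of ws] n(3) by (simp add: P_def)
  qed
  then show ?thesis unfolding GH_def using P
    by (intro Least_le exI[of _ P]) (auto simp: gh_computes_def P_def)
qed

text \<open>Since \<open>GH\<close> takes natural numbers as vertices, a protocol over any countable
  type is transported along \<open>to_nat\<close>. The transported maps fix all numbers outside its
  range.\<close>

lemma GH_le:
  fixes a :: "'x \<Rightarrow> 'v::countable \<Rightarrow> 'v"
  assumes W: "finite W" "t \<notin> W"
    and a: "\<And>x. x \<in> X \<Longrightarrow> matching_map (insert t W) (a x)"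
    and b: "\<And>y. y \<in> Y \<Longrightarrow> matching_map W (b y)"
    and out: "\<And>x y. x \<in> X \<Longrightarrow> y \<in> Y \<Longrightarrow> outputs (a x) (b y) t (h x y)"
  shows "GH X Y h \<le> card W"
proof -
  define c where "c = (\<lambda>(f :: 'v \<Rightarrow> 'v) u. if u \<in> range (to_nat :: 'v \<Rightarrow> nat) then to_nat (f (from_nat u)) else u)"
  have c: "c f (to_nat v) = to_nat (f v)" for f v by (simp add: c_def)
  have c': "c f u = u" if "u \<notin> range (to_nat :: 'v \<Rightarrow> nat)" for f u using that by (simp add: c_def)
  have mm: "matching_map (to_nat ` S) (c f)" if "matching_map S f" for S f
    unfolding matching_map_def
  proof (intro conjI allI impI)
    fix u
    show "c f (c f u) = u"
      using that by (cases "u \<in> range (to_nat :: 'v \<Rightarrow> nat)") (auto simp: c c' matching_map_def)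
    show "c f u = u" if "u \<notin> to_nat ` S"
      using that \<open>matching_map S f\<close>
      by (cases "u \<in> range (to_nat :: 'v \<Rightarrow> nat)") (auto simp: c matching_map_def intro: c')
  qed
  have "GH X Y h \<le> card (to_nat ` W)"
  proof (rule GH_le_nat[where a = "c \<circ> a" and b = "c \<circ> b" and t = "to_nat t"])
    show "matching_map (insert (to_nat t) (to_nat ` W)) ((c \<circ> a) x)" if "x \<in> X" for x
      using mm[OF a[OF that]] by simp
    show "matching_map (to_nat ` W) ((c \<circ> b) y)" if "y \<in> Y" for y
      using mm[OF b[OF that]] by simp
    show "outputs ((c \<circ> a) x) ((c \<circ> b) y) (to_nat t) (h x y)" if xy: "x \<in> X" "y \<in> Y" for x y
    proof -
      obtain n v where n: "walk (a x) (b y) t n v" "(if even n then a x else b y) v = v" "odd n = h x y"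
        using out[OF xy] by (auto simp: outputs_def)
      have "walk (c (a x)) (c (b y)) (to_nat t) n (to_nat v)"
        by (rule walk_map[OF n(1)]) (auto simp: c)
      then show ?thesis using n(2,3) unfolding outputs_def comp_def
        by (intro exI[of _ n] exI[of _ "to_nat v"]) (auto simp: c split: if_splits)
    qed
  qed (use W in auto)
  also have "card (to_nat ` W) = card W" by (simp add: card_image)
  finally show ?thesis .
qed

section \<open>From protocols to walks\<close>

lemma maximal_path_walk:
  assumes A: "is_matching (insert t V) EA" and B: "is_matching V EB" and t: "t \<notin> V"
    and m: "maximal_path_from (EA \<union> EB) t ws"
  shows "walk (mate EA) (mate EB) t (length ws - 1) (last ws)"
    and "(if even (length ws - 1) then mate EA else mate EB) (last ws) = last ws"
proof -
  let ?a = "mate EA" and ?b = "mate EB" and ?n = "length ws - 1"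
  have p: "path_from (EA \<union> EB) t ws" using m by (simp add: maximal_path_from_def)
  then have d: "distinct ws" and w0: "ws ! 0 = t" and ne: "ws \<noteq> []"
    by (auto simp: path_from_def hd_conv_nth)
  have inv: "?a (?a u) = u" "?b (?b u) = u" for u
    using matching_map_mate[OF A] matching_map_mate[OF B] by (auto simp: matching_map_def)
  have bt: "?b t = t" using matching_map_mate[OF B] t by (auto simp: matching_map_def)
  have step: "ws ! Suc i = ?a (ws ! i) \<or> ws ! Suc i = ?b (ws ! i)" if "Suc i < length ws" for i
    using path_from_edge[OF p that] mate_eq[OF A] mate_eq[OF B] by (metis Un_iff)
  have neq: "ws ! i \<noteq> ws ! j" if "i < length ws" "j < length ws" "i \<noteq> j" for i j
    using d that by (simp add: nth_eq_iff_index_eq)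
  \<comment> \<open>The first edge is Alice's because Bob leaves the tap unmatched. Two consecutive
    edges of the same matching would lead back to a vertex already visited.\<close>
  have alt: "ws ! Suc i = (if even i then ?a else ?b) (ws ! i)" if "Suc i < length ws" for i
    using that
  proof (induction i)
    case 0
    then show ?case using step[of 0] bt w0 neq[of "Suc 0" 0] ne by auto
  next
    case (Suc i)
    then show ?case using step[of "Suc i"] neq[of i "Suc (Suc i)"] inv by auto
  qed
  have l: "last ws = ws ! ?n" using ne by (simp add: last_conv_nth)
  have "walk ?a ?b (ws ! 0) ?n (ws ! ?n)"
  proof (rule walk_seq)
    fix i assume "i < ?n"
    then have "Suc i < length ws" by simp
    then show "ws ! Suc i = (if even i then ?a else ?b) (ws ! i)" "ws ! Suc i \<noteq> ws ! i"
      using alt neq[of "Suc i" i] by auto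
  qed
  then show w: "walk ?a ?b t ?n (last ws)" using l w0 by simp
  show "(if even ?n then ?a else ?b) (last ws) = last ws"
  proof (rule ccontr)
    let ?u = "(if even ?n then ?a else ?b) (last ws)"
    assume ne': "?u \<noteq> last ws"
    \<comment> \<open>If the walk could go on, \<open>walk_seq_inj\<close> for the sequence
      prolonged by \<open>?u\<close> would show that \<open>?u\<close> is new, so that the path
      would not be maximal.\<close>
    define f where "f i = (if i < length ws then ws ! i else ?u)" for i
    have "inj_on f {..length ws}"
    proof (rule walk_seq_inj[of ?a ?b])
      show "f (Suc i) = (if even i then ?a else ?b) (f i)" if "i < length ws" for i
      proof (cases "Suc i < length ws")
        case True
        then show ?thesis using that alt[of i] by (simp add: f_def)
      next
        case False
        then have "i = ?n" using that by simp
        then show ?thesis using l that False by (simp add: f_def)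
      qed
      show "f (Suc i) \<noteq> f i" if "i < length ws" for i
      proof (cases "Suc i < length ws")
        case True
        then show ?thesis using neq[of "Suc i" i] by (simp add: f_def)
      next
        case False
        then have "i = ?n" using that by simp
        then show ?thesis using ne' l that False by (simp add: f_def)
      qed
    qed (use inv bt w0 ne in \<open>auto simp: f_def\<close>)
    then have "?u \<noteq> ws ! i" if "i < length ws" for i
      using that inj_onD[of f "{..length ws}" "length ws" i] by (auto simp: f_def)
    then have "?u \<notin> set ws" by (metis in_set_conv_nth)
    moreover have "{last ws, ?u} \<in> EA \<union> EB"
      using ne' edge_mate[OF A] edge_mate[OF B] by (auto split: if_splits)
    ultimately have "path_from (EA \<union> EB) t (ws @ [?u])"
      using p by (auto simp: path_from_def successively_append_iff)
    then show False using m by (simp add: maximal_path_from_def)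
  qed
qed

lemma ex_optimal_protocol:
  fixes h :: "'x \<Rightarrow> 'y \<Rightarrow> bool"
  assumes "finite X"
  shows "\<exists>V t (a :: 'x \<Rightarrow> nat \<Rightarrow> nat) (b :: 'y \<Rightarrow> nat \<Rightarrow> nat).
    finite V \<and> t \<notin> V \<and> card V = GH X Y h \<and>
    (\<forall>x\<in>X. matching_map (insert t V) (a x)) \<and> (\<forall>y\<in>Y. matching_map V (b y)) \<and>
    (\<forall>x\<in>X. \<forall>y\<in>Y. outputs (a x) (b y) t (h x y))"
proof -
  have "\<exists>s. \<exists>P :: ('x, 'y, nat) garden_hose.
      gh_protocol X Y P \<and> card (pipes P) = s \<and> gh_computes X Y P h"
    using ex_protocol[OF assms] by blast
  then have "\<exists>P :: ('x, 'y, nat) garden_hose.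
      gh_protocol X Y P \<and> card (pipes P) = GH X Y h \<and> gh_computes X Y P h"
    unfolding GH_def by (rule LeastI_ex)
  then obtain P :: "('x, 'y, nat) garden_hose" where
    P: "gh_protocol X Y P" "card (pipes P) = GH X Y h" "gh_computes X Y P h" by blast
  have "outputs (mate (alice P x)) (mate (bob P y)) (tap P) (h x y)" if xy: "x \<in> X" "y \<in> Y" for x y
  proof -
    obtain ws where ws: "maximal_path_from (alice P x \<union> bob P y) (tap P) ws"
      using ex1_maximal_path[OF P(1) xy] by blast
    have "odd (length ws - 1) = h x y"
      using gh_output_eq[OF P(1) xy ws] P(3) xy by (auto simp: gh_computes_def)
    then show ?thesis
      unfolding outputs_def
      using maximal_path_walk[OF _ _ _ ws, of "pipes P"] P(1) xy unfolding gh_protocol_def by blast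
  qed
  then show ?thesis
    using P
    by (intro exI[of _ "pipes P"] exI[of _ "tap P"] exI[of _ "\<lambda>x. mate (alice P x)"]
        exI[of _ "\<lambda>y. mate (bob P y)"])
       (auto simp: gh_protocol_def intro!: matching_map_mate)
qed

text \<open>Without pipes the tap is the only vertex, so the path has no edge and the output is
  false.\<close>

lemma GH_eq_0_D:
  fixes h :: "'x \<Rightarrow> 'y \<Rightarrow> bool"
  assumes "finite X" "GH X Y h = 0" "x \<in> X" "y \<in> Y"
  shows "\<not> h x y"
proof -
  obtain V t and a :: "'x \<Rightarrow> nat \<Rightarrow> nat" and b :: "'y \<Rightarrow> nat \<Rightarrow> nat" where V: "finite V" "card V = 0" "matching_map (insert t V) (a x)"
    "outputs (a x) (b y) t (h x y)"
    using ex_optimal_protocol[OF assms(1), of Y h] assms(2-4) by metis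
  have "matching_map {t} (a x)" using V by simp
  then have "a x u = u" for u by (metis matching_map_def singletonD)
  with V(4) show ?thesis by (auto simp: outputs_def elim: walk.cases)
qed

section \<open>Networks of switches\<close>

text \<open>A switch has the terminals 0 (input), 1 (output for true) and 2 (output for false). They are the
  taps of three copies of a protocol. The numbers 3, 4, 5 stand for dead ends attached to them by \<open>L\<close>, which flip the parity of the path
  and hence the output.\<close>

definition crosses :: "bool \<Rightarrow> nat \<Rightarrow> nat \<Rightarrow> bool" where
  "crosses r c d \<longleftrightarrow> c = 0 \<and> d = (if r then 1 else 2) \<or> d = 0 \<and> c = (if r then 1 else 2)"

text \<open>The route of the water, seen at the level of switches. Every crossing takes an odd
  number of edges and every link exactly one. So stopping right after a crossing means output true,
  and one more edge into a dead end means output false.\<close>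

inductive routed :: "('q \<Rightarrow> bool) \<Rightarrow> ('q \<times> nat \<Rightarrow> 'q \<times> nat) \<Rightarrow> 'q \<times> nat \<Rightarrow> bool \<Rightarrow> bool"
  for z L where
  accept: "crosses (z q) c d \<Longrightarrow> L (q, d) = (q, d) \<Longrightarrow> routed z L (q, c) True"
| reject: "crosses (z q) c d \<Longrightarrow> L (q, d) = (q', d') \<Longrightarrow> d' \<ge> 3 \<Longrightarrow> routed z L (q, c) False"
| link: "crosses (z q) c d \<Longrightarrow> L (q, d) = (q', d') \<Longrightarrow> (q', d') \<noteq> (q, d) \<Longrightarrow> d' < 3 \<Longrightarrow>
    routed z L (q', d') r \<Longrightarrow> routed z L (q, c) r"

text \<open>The wiring \<open>L\<close> does not depend on the inputs. It can be left to Bob, whose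
  matchings in the given protocols never touch the taps.\<close>

locale switch_network =
  fixes X :: "'x set" and Y :: "'y set" and S :: "'q::countable set" and lab :: "'q \<Rightarrow> 'i"
    and L :: "'q \<times> nat \<Rightarrow> 'q \<times> nat"
    and V :: "'i \<Rightarrow> nat set" and t :: "'i \<Rightarrow> nat"
    and a :: "'i \<Rightarrow> 'x \<Rightarrow> nat \<Rightarrow> nat" and b :: "'i \<Rightarrow> 'y \<Rightarrow> nat \<Rightarrow> nat"
    and z :: "'i \<Rightarrow> 'x \<Rightarrow> 'y \<Rightarrow> bool"
  assumes S: "finite S" and L: "matching_map (S \<times> {..<6}) L"
    and V: "\<And>q. q \<in> S \<Longrightarrow> finite (V (lab q))" "\<And>q. q \<in> S \<Longrightarrow> t (lab q) \<notin> V (lab q)"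
    and a: "\<And>q x. q \<in> S \<Longrightarrow> x \<in> X \<Longrightarrow> matching_map (insert (t (lab q)) (V (lab q))) (a (lab q) x)"
    and b: "\<And>q y. q \<in> S \<Longrightarrow> y \<in> Y \<Longrightarrow> matching_map (V (lab q)) (b (lab q) y)"
    and z: "\<And>q x y. q \<in> S \<Longrightarrow> x \<in> X \<Longrightarrow> y \<in> Y \<Longrightarrow>
      outputs (a (lab q) x) (b (lab q) y) (t (lab q)) (z (lab q) x y)"
begin

section \<open>The two matchings of a network\<close>

definition "terminal p = (fst p, snd p, t (lab (fst p)))"

text \<open>A path that gets stuck on Alice's turn has even length, so the function is false; she
  then joins its end to the twin in copy 2, the copy whose tap is the output for false. Bob does the
  same with copy 1.\<close>

definition alice_map :: "'x \<Rightarrow> 'q \<times> nat \<times> nat \<Rightarrow> 'q \<times> nat \<times> nat" where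
  "alice_map x = (\<lambda>(q, c, v).
     if q \<in> S \<and> c < 3 \<and> v \<in> insert (t (lab q)) (V (lab q)) then
       if a (lab q) x v \<noteq> v then (q, c, a (lab q) x v)
       else (q, if c = 0 then 2 else if c = 2 then 0 else c, v)
     else (q, c, v))"

definition bob_map :: "'y \<Rightarrow> 'q \<times> nat \<times> nat \<Rightarrow> 'q \<times> nat \<times> nat" where
  "bob_map y = (\<lambda>(q, c, v).
     if q \<in> S \<and> v = t (lab q) then terminal (L (q, c))
     else if q \<in> S \<and> c < 3 \<and> v \<in> V (lab q) then
       if b (lab q) y v \<noteq> v then (q, c, b (lab q) y v)
       else (q, if c = 0 then 1 else if c = 1 then 0 else c, v)
     else (q, c, v))"

definition vertices :: "('q \<times> nat \<times> nat) set" where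
  "vertices = (SIGMA q:S. {..<3} \<times> V (lab q) \<union> {..<6} \<times> {t (lab q)})"

lemma L_in_S: "q \<in> S \<Longrightarrow> L (q, c) = (q', c') \<Longrightarrow> q' \<in> S"
  using L unfolding matching_map_def by (metis SigmaD1 Pair_inject)

lemma L_L: "L (L p) = p"
  using L unfolding matching_map_def by blast

lemma L_outside: "c \<ge> 6 \<Longrightarrow> L (q, c) = (q, c)"
  using L by (auto simp: matching_map_def)

lemma a_a: "q \<in> S \<Longrightarrow> x \<in> X \<Longrightarrow> a (lab q) x (a (lab q) x v) = v"
  using a by (simp add: matching_map_def)

lemma b_b: "q \<in> S \<Longrightarrow> y \<in> Y \<Longrightarrow> b (lab q) y (b (lab q) y v) = v"
  using b by (simp add: matching_map_def)

lemma a_in: "q \<in> S \<Longrightarrow> x \<in> X \<Longrightarrow> a (lab q) x v \<noteq> v \<Longrightarrow> v \<in> insert (t (lab q)) (V (lab q))"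
  using a unfolding matching_map_def by blast

lemma b_in: "q \<in> S \<Longrightarrow> y \<in> Y \<Longrightarrow> b (lab q) y v \<noteq> v \<Longrightarrow> v \<in> V (lab q)"
  using b unfolding matching_map_def by blast

lemma alice_map_involution:
  assumes "x \<in> X"
  shows "alice_map x (alice_map x p) = p"
proof (cases p)
  case (fields q c v)
  have "a (lab q) x v \<in> insert (t (lab q)) (V (lab q))" if "q \<in> S" "a (lab q) x v \<noteq> v"
    using a_in[of q x "a (lab q) x v"] a_a[of q x] that assms by auto
  then show ?thesis using fields assms by (auto simp: alice_map_def a_a)
qed

lemma bob_map_involution:
  assumes "y \<in> Y"
  shows "bob_map y (bob_map y p) = p"
proof (cases p)
  case (fields q c v)
  show ?thesis
  proof (cases "q \<in> S \<and> v = t (lab q)")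
    case True
    obtain q' c' where L': "L (q, c) = (q', c')" by fastforce
    then have "q' \<in> S" "L (q', c') = (q, c)" using True L_in_S L_L by metis+
    then show ?thesis using True L' fields by (simp add: bob_map_def terminal_def)
  next
    case False
    have "b (lab q) y v \<in> V (lab q)" if "q \<in> S" "b (lab q) y v \<noteq> v"
      using b_in[of q y "b (lab q) y v"] b_b[of q y] that assms by auto
    then show ?thesis using fields assms False V(2) by (auto simp: bob_map_def b_b)
  qed
qed

lemma matching_map_alice:
  assumes "x \<in> X"
  shows "matching_map vertices (alice_map x)"
  using assms by (auto simp: matching_map_def alice_map_involution) (auto simp: alice_map_def vertices_def)

lemma matching_map_bob:
  assumes "y \<in> Y"
  shows "matching_map vertices (bob_map y)"
  using assms
  by (auto simp: matching_map_def bob_map_involution)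
     (auto simp: bob_map_def vertices_def terminal_def L_outside not_less)

section \<open>Crossing a switch\<close>

lemma walk_copy:
  assumes "q \<in> S" "c < 3" "x \<in> X" "y \<in> Y"
  shows "walk (a (lab q) x) (b (lab q) y) u n v \<Longrightarrow>
      walk (alice_map x) (bob_map y) (q, c, u) n (q, c, v)"
    and "walk (b (lab q) y) (a (lab q) x) u n v \<Longrightarrow>
      walk (bob_map y) (alice_map x) (q, c, u) n (q, c, v)"
proof -
  have A: "alice_map x (q, c, v) = (q, c, a (lab q) x v)" if "a (lab q) x v \<noteq> v" for v
    using a_in[OF assms(1,3) that] that assms by (auto simp: alice_map_def)
  have B: "bob_map y (q, c, v) = (q, c, b (lab q) y v)" if "b (lab q) y v \<noteq> v" for v
    using b_in[OF assms(1,4) that] that assms V(2) by (auto simp: bob_map_def)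
  have i: "inj (\<lambda>v. (q, c, v))" by (simp add: inj_def)
  show "walk (alice_map x) (bob_map y) (q, c, u) n (q, c, v)"
    if "walk (a (lab q) x) (b (lab q) y) u n v"
    using walk_map[OF that i] A B by blast
  show "walk (bob_map y) (alice_map x) (q, c, u) n (q, c, v)"
    if "walk (b (lab q) y) (a (lab q) x) u n v"
    using walk_map[OF that i] A B by blast
qed

text \<open>Bob joins copies only at pipes because he uses the taps for \<open>L\<close>. So a walk
  that ends on his turn must not end at the tap, and indeed no walk returns there by
  \<open>walk_seq_inj\<close>.\<close>

lemma walk_end_in_V:
  assumes "q \<in> S" "x \<in> X" "y \<in> Y" "walk (a (lab q) x) (b (lab q) y) (t (lab q)) n v" "n \<noteq> 0"
  shows "v \<in> V (lab q)"
proof -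
  obtain f where f: "f 0 = t (lab q)" "f n = v"
    "\<And>m. m < n \<Longrightarrow> f (Suc m) = (if even m then a (lab q) x else b (lab q) y) (f m)"
    "\<And>m. m < n \<Longrightarrow> f (Suc m) \<noteq> f m"
    using walk_seqE[OF assms(4)] by metis
  have bt: "b (lab q) y (f 0) = f 0"
    using b_in[of q y "f 0"] V(2) assms f(1) by auto
  have "inj_on f {..n}"
    by (rule walk_seq_inj[of "a (lab q) x" "b (lab q) y"]) (use a_a b_b bt f assms in auto)
  then have "v \<noteq> t (lab q)"
    using inj_onD[of f "{..n}" n 0] f(1,2) assms(5) by auto
  moreover obtain m where "n = Suc m" using assms(5) by (cases n) auto
  then have "a (lab q) x v \<noteq> v \<or> b (lab q) y v \<noteq> v"
    using f(2) f(3)[of m] f(4)[of m] a_a[OF assms(1,2), of "f m"] b_b[OF assms(1,3), of "f m"]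
    by (auto split: if_splits)
  ultimately show ?thesis using a_in[OF assms(1,2)] b_in[OF assms(1,3)] by blast
qed

text \<open>The path of the first copy is retraced backwards in the second or the third one, depending
  on whether it was Bob or Alice who could not extend it.\<close>

lemma walk_switch:
  assumes q: "q \<in> S" and x: "x \<in> X" and y: "y \<in> Y"
  shows "\<exists>n. odd n \<and> walk (alice_map x) (bob_map y) (terminal (q, 0)) n
    (terminal (q, if z (lab q) x y then 1 else 2))"
proof -
  let ?a = "a (lab q) x" and ?b = "b (lab q) y" and ?t = "t (lab q)"
  obtain n v where n: "walk ?a ?b ?t n v" "(if even n then ?a else ?b) v = v" "odd n = z (lab q) x y"
    using z[OF q x y] by (auto simp: outputs_def)
  have w: "walk (alice_map x) (bob_map y) (q, 0, ?t) n (q, 0, v)"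
    using walk_copy(1)[OF q _ x y n(1)] by simp
  have r: "if even n then walk ?b ?a v n ?t else walk ?a ?b v n ?t"
    using walk_rev[OF n(1)] a_a b_b q x y by blast
  have v: "v \<in> V (lab q)" if "n \<noteq> 0"
    using walk_end_in_V[OF q x y n(1) that] .
  have v0: "v = ?t" if "n = 0"
    using n(1) that by (auto elim: walk.cases)
  show ?thesis
  proof (cases "even n")
    case True
    \<comment> \<open>For \<open>n = 0\<close> the end is the tap itself, which Alice may also join
      to its twin.\<close>
    have "alice_map x (q, 0, v) = (q, 2, v)"
      using True n(2) v v0 q by (cases "n = 0") (auto simp: alice_map_def)
    then have "walk (alice_map x) (bob_map y) (q, 0, v) 1 (q, 2, v)"
      using walk_1[of "alice_map x" "(q, 0, v)"] by simp
    then have w': "walk (alice_map x) (bob_map y) (q, 0, ?t) (n + 1) (q, 2, v)"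
      using walk_append[OF w] True by blast
    have "walk (bob_map y) (alice_map x) (q, 2, v) n (q, 2, ?t)"
      using walk_copy(2)[OF q _ x y, of 2] r True by simp
    then have "walk (alice_map x) (bob_map y) (q, 0, ?t) (n + 1 + n) (q, 2, ?t)"
      by (intro walk_append[OF w']) (use True in auto)
    then show ?thesis using True n(3) unfolding terminal_def
      by (intro exI[of _ "n + 1 + n"]) auto
  next
    case False
    then have "v \<in> V (lab q)" "v \<noteq> ?t" using v V(2)[OF q] by (metis even_zero)+
    then have "bob_map y (q, 0, v) = (q, 1, v)"
      using False n(2) q by (auto simp: bob_map_def)
    then have "walk (bob_map y) (alice_map x) (q, 0, v) 1 (q, 1, v)"
      using walk_1[of "bob_map y" "(q, 0, v)"] by simp
    then have w': "walk (alice_map x) (bob_map y) (q, 0, ?t) (n + 1) (q, 1, v)"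
      using walk_append[OF w] False by blast
    have "walk (alice_map x) (bob_map y) (q, 1, v) n (q, 1, ?t)"
      using walk_copy(1)[OF q _ x y, of 1] r False by simp
    then have "walk (alice_map x) (bob_map y) (q, 0, ?t) (n + 1 + n) (q, 1, ?t)"
      by (intro walk_append[OF w']) (use False in auto)
    then show ?thesis using False n(3) unfolding terminal_def
      by (intro exI[of _ "n + 1 + n"]) auto
  qed
qed

text \<open>A switch can be crossed in both directions, since the reverse of a walk of odd length
  again starts with Alice.\<close>

lemma walk_crosses:
  assumes "q \<in> S" "x \<in> X" "y \<in> Y" "crosses (z (lab q) x y) c d"
  shows "\<exists>n. odd n \<and> walk (alice_map x) (bob_map y) (terminal (q, c)) n (terminal (q, d))"
proof -
  let ?d = "if z (lab q) x y then 1 else 2 :: nat"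
  obtain n where n: "odd n" "walk (alice_map x) (bob_map y) (terminal (q, 0)) n (terminal (q, ?d))"
    using walk_switch[OF assms(1-3)] by blast
  have "walk (alice_map x) (bob_map y) (terminal (q, ?d)) n (terminal (q, 0))"
    using walk_rev[OF n(2)] n(1) alice_map_involution[OF assms(2)] bob_map_involution[OF assms(3)]
    by simp
  then show ?thesis using n assms(4) unfolding crosses_def by blast
qed

lemma bob_map_terminal: "q \<in> S \<Longrightarrow> bob_map y (terminal (q, c)) = terminal (L (q, c))"
  by (simp add: bob_map_def terminal_def)

section \<open>Output and size of a network\<close>

lemma outputs_routed:
  assumes "routed (\<lambda>q. z (lab q) x y) L p r" "fst p \<in> S" "x \<in> X" "y \<in> Y"
  shows "outputs (alice_map x) (bob_map y) (terminal p) r"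
  using assms(1,2)
proof (induction rule: routed.induct)
  case (accept q c d)
  then obtain n where "odd n" "walk (alice_map x) (bob_map y) (terminal (q, c)) n (terminal (q, d))"
    using walk_crosses[of q x y c d] assms(3,4) by auto
  then show ?case unfolding outputs_def
    using accept by (intro exI[of _ n] exI[of _ "terminal (q, d)"]) (auto simp: bob_map_terminal)
next
  case (reject q c d q' d')
  then obtain n where n: "odd n" "walk (alice_map x) (bob_map y) (terminal (q, c)) n (terminal (q, d))"
    using walk_crosses[of q x y c d] assms(3,4) by auto
  have "bob_map y (terminal (q, d)) = terminal (q', d')" using reject by (simp add: bob_map_terminal)
  moreover have "(q', d') \<noteq> (q, d)" using reject by (auto simp: crosses_def split: if_splits)
  then have "terminal (q', d') \<noteq> terminal (q, d)" by (auto simp: terminal_def)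
  ultimately have "walk (bob_map y) (alice_map x) (terminal (q, d)) 1 (terminal (q', d'))"
    using walk_1 by metis
  then have "walk (alice_map x) (bob_map y) (terminal (q, c)) (n + 1) (terminal (q', d'))"
    using walk_append[OF n(2)] n(1) by blast
  moreover have "alice_map x (terminal (q', d')) = terminal (q', d')"
    using reject by (simp add: alice_map_def terminal_def)
  ultimately show ?case unfolding outputs_def
    using n(1) by (intro exI[of _ "n + 1"] exI[of _ "terminal (q', d')"]) auto
next
  case (link q c d q' d' r)
  then obtain n where n: "odd n" "walk (alice_map x) (bob_map y) (terminal (q, c)) n (terminal (q, d))"
    using walk_crosses[of q x y c d] assms(3,4) by auto
  have "bob_map y (terminal (q, d)) = terminal (q', d')" using link by (simp add: bob_map_terminal)
  moreover have "terminal (q', d') \<noteq> terminal (q, d)" using link by (auto simp: terminal_def)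
  ultimately have "walk (bob_map y) (alice_map x) (terminal (q, d)) 1 (terminal (q', d'))"
    using walk_1 by metis
  then have w: "walk (alice_map x) (bob_map y) (terminal (q, c)) (n + 1) (terminal (q', d'))"
    using walk_append[OF n(2)] n(1) by blast
  have "q' \<in> S" using link L_in_S by (metis fst_conv)
  then obtain m v where m: "walk (alice_map x) (bob_map y) (terminal (q', d')) m v"
    "(if even m then alice_map x else bob_map y) v = v" "odd m = r"
    using link.IH by (auto simp: outputs_def)
  have "walk (alice_map x) (bob_map y) (terminal (q, c)) (n + 1 + m) v"
    by (rule walk_append[OF w]) (use n m in auto)
  then show ?case unfolding outputs_def
    using n(1) m(2,3) by (intro exI[of _ "n + 1 + m"] exI[of _ v]) auto
qed

lemma finite_vertices: "finite vertices"
  using S V unfolding vertices_def by (intro finite_SigmaI) auto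

lemma card_vertices: "card vertices \<le> (\<Sum>q\<in>S. 3 * card (V (lab q)) + 6)"
proof -
  have "card vertices = (\<Sum>q\<in>S. card ({..<3::nat} \<times> V (lab q) \<union> {..<6::nat} \<times> {t (lab q)}))"
    unfolding vertices_def by (rule card_SigmaI) (use S V in auto)
  also have "\<dots> \<le> (\<Sum>q\<in>S. 3 * card (V (lab q)) + 6)"
    by (intro sum_mono order.trans[OF card_Un_le]) (simp add: card_cartesian_product)
  finally show ?thesis .
qed

lemma GH_le_network:
  assumes q0: "q0 \<in> S" "L (q0, 0) = (q0, 0)"
    and h: "\<And>x y. x \<in> X \<Longrightarrow> y \<in> Y \<Longrightarrow> routed (\<lambda>q. z (lab q) x y) L (q0, 0) (h x y)"
  shows "GH X Y h \<le> (\<Sum>q\<in>S. 3 * card (V (lab q)) + 6)"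
proof -
  let ?t = "terminal (q0, 0)"
  have t: "?t \<in> vertices" using q0 by (auto simp: vertices_def terminal_def)
  \<comment> \<open>The initial terminal becomes the tap of the new protocol and is therefore not a
    pipe. Bob leaves it unmatched because \<open>L\<close> fixes it.\<close>
  have "GH X Y h \<le> card (vertices - {?t})"
  proof (rule GH_le[where t = ?t])
    show "matching_map (insert ?t (vertices - {?t})) (alice_map x)" if "x \<in> X" for x
      using matching_map_alice[OF that] t by (simp add: insert_absorb)
    show "matching_map (vertices - {?t}) (bob_map y)" if "y \<in> Y" for y
      using matching_map_bob[OF that] bob_map_terminal[OF q0(1), of y 0] q0(2)
      by (auto simp: matching_map_def)
    show "outputs (alice_map x) (bob_map y) ?t (h x y)" if "x \<in> X" "y \<in> Y" for x y
      using outputs_routed[OF h] that q0 by simp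
  qed (use finite_vertices in auto)
  also have "\<dots> \<le> card vertices" by (rule card_mono[OF finite_vertices]) auto
  finally show ?thesis using card_vertices by linarith
qed

end

section \<open>Reversible branching programs\<close>

lemma is_matching_links:
  assumes "inj_on g D" "g ` D \<inter> D = {}" "D \<union> g ` D \<subseteq> W"
  shows "is_matching W {{u, g u} | u. u \<in> D}"
  unfolding is_matching_def
proof (intro conjI ballI)
  fix e assume "e \<in> {{u, g u} | u. u \<in> D}"
  then obtain u where "e = {u, g u}" "u \<in> D" by blast
  then show "e \<subseteq> W" "card e = 2" using assms by (auto simp: card_insert_if)
next
  show "pairwise disjnt {{u, g u} | u. u \<in> D}"
  proof (rule pairwiseI)
    fix e e' assume "e \<in> {{u, g u} | u. u \<in> D}" "e' \<in> {{u, g u} | u. u \<in> D}" "e \<noteq> e'"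
    then obtain u v where *: "e = {u, g u}" "u \<in> D" "e' = {v, g v}" "v \<in> D" "u \<noteq> v" by blast
    then have "g u \<noteq> g v" "g u \<noteq> v" "u \<noteq> g v" using assms(1,2) by (auto dest: inj_onD)
    then show "disjnt e e'" using * by (auto simp: disjnt_def)
  qed
qed

datatype outcome = Go nat | Accept | Reject

type_synonym 'i layer = "'i \<times> (nat \<Rightarrow> nat) \<times> (nat \<Rightarrow> outcome)"

fun run :: "('i \<Rightarrow> bool) \<Rightarrow> 'i layer list \<Rightarrow> nat \<Rightarrow> outcome" where
  "run z [] s = Go s"
| "run z ((i, p, e) # P) s =
    (case e (if z i then p s else s) of Go s' \<Rightarrow> run z P s' | Accept \<Rightarrow> Accept | Reject \<Rightarrow> Reject)"

text \<open>Both the permutation and the exit map are injective on running states, so a program never merges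
  two computations that are still running.\<close>

fun reversible_layer :: "nat \<Rightarrow> 'i layer \<Rightarrow> bool" where
  "reversible_layer W (i, p, e) \<longleftrightarrow> p permutes {..<W} \<and>
    (\<forall>s<W. \<forall>u. e s = Go u \<longrightarrow> u < W \<and> (\<forall>r<W. e r = Go u \<longrightarrow> r = s))"

section \<open>The network of a program\<close>

locale program_network =
  fixes P :: "'i layer list" and W :: nat
  assumes rev: "\<And>l. l \<in> set P \<Longrightarrow> reversible_layer W l"
begin

abbreviation "var l \<equiv> fst (P ! l)"
abbreviation "perm l \<equiv> fst (snd (P ! l))"
abbreviation "exit l \<equiv> snd (snd (P ! l))"

lemma layer: "l < length P \<Longrightarrow> reversible_layer W (var l, perm l, exit l)"
  using rev[OF nth_mem] by simp

lemma perm: "l < length P \<Longrightarrow> perm l permutes {..<W}"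
  using layer[of l] unfolding reversible_layer.simps by blast

lemma exit_less: "l < length P \<Longrightarrow> s < W \<Longrightarrow> exit l s = Go u \<Longrightarrow> u < W"
  using layer[of l] unfolding reversible_layer.simps by blast

lemma exit_inj: "l < length P \<Longrightarrow> s < W \<Longrightarrow> r < W \<Longrightarrow> exit l s = Go u \<Longrightarrow> exit l r = Go u \<Longrightarrow> r = s"
  using layer[of l] unfolding reversible_layer.simps by blast

text \<open>Every state of layer \<open>l\<close> is a switch \<open>(l, True, s)\<close>; the two ways to reach a state after
  the permutation are joined by a switch \<open>(l, False, s)\<close> that is traversed backwards.\<close>

definition switches :: "(nat \<times> bool \<times> nat) set" where
  "switches = {..<length P} \<times> UNIV \<times> {..<W}"

text \<open>Terminal \<open>c\<close> of the first switch is joined to terminal \<open>c\<close> of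
  a second one with the same variable. The value that led the water to \<open>c\<close> therefore
  leads it backwards through the second switch to terminal 0.\<close>

definition link :: "(nat \<times> bool \<times> nat) \<times> nat \<Rightarrow> (nat \<times> bool \<times> nat) \<times> nat" where
  "link = (\<lambda>((l, d, s), c).
     if d then ((l, False, if c = 1 then perm l s else s), c)
     else case exit l s of Go u \<Rightarrow> ((Suc l, True, u), 0) | _ \<Rightarrow> ((l, False, s), 3))"

text \<open>One end of every edge. Accepting states contribute none, since \<open>routed\<close>
  accepts at an unmatched terminal; nor does \<open>Go\<close> in the last layer, which has no
  successor.\<close>

definition tails :: "((nat \<times> bool \<times> nat) \<times> nat) set" where
  "tails = {((l, True, s), c) | l s c. l < length P \<and> s < W \<and> c \<in> {1, 2}} \<union>
     {((l, False, s), 0) | l s. l < length P \<and> s < W \<and>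
        (exit l s = Reject \<or> (\<exists>u. exit l s = Go u \<and> Suc l < length P))}"

definition linkage :: "(nat \<times> bool \<times> nat) \<times> nat \<Rightarrow> (nat \<times> bool \<times> nat) \<times> nat" where
  "linkage = mate {{p, link p} | p. p \<in> tails}"

lemma perm_eq: "l < length P \<Longrightarrow> perm l s = perm l r \<longleftrightarrow> s = r"
  using permutes_inj[OF perm] by (simp add: inj_eq)

lemma perm_less: "l < length P \<Longrightarrow> perm l s < W \<longleftrightarrow> s < W"
  using permutes_in_image[OF perm] by (simp add: lessThan_iff[symmetric] del: lessThan_iff)

text \<open>This is where reversibility enters: as permutations and exit maps are injective, no two
  edges meet at a terminal.\<close>

lemma is_matching_linkage: "is_matching (switches \<times> {..<6}) {{p, link p} | p. p \<in> tails}"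
proof (rule is_matching_links)
  show "inj_on link tails"
    by (rule inj_onI)
      (auto simp: tails_def link_def perm_eq split: outcome.splits if_splits dest: exit_inj)
  show "link ` tails \<inter> tails = {}"
    by (auto simp: tails_def link_def split: outcome.splits)
  show "tails \<union> link ` tails \<subseteq> switches \<times> {..<6}"
    by (auto simp: tails_def link_def switches_def perm_less split: outcome.splits intro: exit_less[OF Suc_lessD])
qed

lemma linkage_tail: "p \<in> tails \<Longrightarrow> linkage p = link p"
  unfolding linkage_def using mate_eq[OF is_matching_linkage] by blast

lemma linkage_fixed: "p \<notin> tails \<Longrightarrow> p \<notin> link ` tails \<Longrightarrow> linkage p = p"
  unfolding linkage_def by (rule mate_fixed) (auto simp: doubleton_eq_iff)

lemma linkage_start: "linkage ((0, True, s), 0) = ((0, True, s), 0)"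
  by (rule linkage_fixed) (auto simp: tails_def link_def split: outcome.splits)

lemma routed_run:
  assumes "l \<le> length P" "s < W" "run z (drop l P) s = r" "\<And>u. r \<noteq> Go u"
  shows "routed (\<lambda>q. z (var (fst q))) linkage ((l, True, s), 0) (r = Accept)"
  using assms
proof (induction "length P - l" arbitrary: l s)
  case (Suc n)
  then have l: "l < length P" by simp
  define c where "c = (if z (var l) then 1 else 2 :: nat)"
  define s1 where "s1 = (if z (var l) then perm l s else s)"
  have s1: "s1 < W" using Suc.prems(2) perm_less[OF l] by (simp add: s1_def)
  have r: "r = (case exit l s1 of Go s' \<Rightarrow> run z (drop (Suc l) P) s' | e \<Rightarrow> e)"
    using Suc.prems(3) Cons_nth_drop_Suc[OF l, symmetric]
    by (cases "P ! l"; cases "z (var l)") (auto simp: s1_def split: outcome.splits)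
  have mid: "linkage ((l, True, s), c) = ((l, False, s1), c)"
    using l Suc.prems(2) by (subst linkage_tail) (auto simp: tails_def link_def c_def s1_def)
  have "routed (\<lambda>q. z (var (fst q))) linkage ((l, False, s1), c) (r = Accept)"
  proof (cases "exit l s1")
    case (Go u)
    then have r': "run z (drop (Suc l) P) u = r" using r by simp
    \<comment> \<open>If the last layer said \<open>Go\<close>, the whole run would end with
      \<open>Go\<close>, contrary to the assumption on \<open>r\<close>.\<close>
    have "Suc l < length P"
    proof (rule ccontr)
      assume "\<not> Suc l < length P"
      then show False using r' Suc.prems(4) by auto
    qed
    moreover have "u < W" using exit_less[OF l s1 Go] .
    ultimately have "routed (\<lambda>q. z (var (fst q))) linkage ((Suc l, True, u), 0) (r = Accept)"
      using Suc.hyps(1)[of "Suc l" u] Suc.hyps(2) Suc.prems(4) r' by simp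
    moreover have "linkage ((l, False, s1), 0) = ((Suc l, True, u), 0)"
      using l s1 Go \<open>Suc l < length P\<close> by (subst linkage_tail) (auto simp: tails_def link_def)
    ultimately show ?thesis
      by (intro routed.link[of _ _ c 0]) (auto simp: crosses_def c_def)
  next
    case Accept
    have "linkage ((l, False, s1), 0) = ((l, False, s1), 0)"
      by (rule linkage_fixed) (use Accept in \<open>auto simp: tails_def link_def split: outcome.splits if_splits\<close>)
    then show ?thesis using routed.accept[of _ "(l, False, s1)" c 0] Accept r
      by (auto simp: crosses_def c_def)
  next
    case Reject
    have "linkage ((l, False, s1), 0) = ((l, False, s1), 3)"
      using l s1 Reject by (subst linkage_tail) (auto simp: tails_def link_def)
    then show ?thesis using routed.reject[of _ "(l, False, s1)" c 0] Reject r
      by (auto simp: crosses_def c_def)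
  qed
  then show ?case
    using mid by (intro routed.link[of _ _ 0 c]) (auto simp: crosses_def c_def)
qed auto

end

section \<open>Protocol size from program cost\<close>

definition cost :: "('i \<Rightarrow> nat) \<Rightarrow> 'i layer list \<Rightarrow> nat" where
  "cost w P = (\<Sum>(i, p, e)\<leftarrow>P. w i)"

text \<open>Each of the \<open>W\<close> states of a layer has two switches. As the complexity of a
  queried function is positive, 3 times it plus 6 is at most 9 times it, which gives the factor 18 =
  2 * 9.\<close>

lemma GH_le_program:
  fixes f :: "'i \<Rightarrow> 'x' \<Rightarrow> 'y' \<Rightarrow> bool" and g :: "'i \<Rightarrow> 'x \<Rightarrow> 'x'" and h :: "'i \<Rightarrow> 'y \<Rightarrow> 'y'"
  assumes fin: "finite X'"
    and g: "\<And>i x. i \<in> I \<Longrightarrow> x \<in> X \<Longrightarrow> g i x \<in> X'" and h: "\<And>i y. i \<in> I \<Longrightarrow> y \<in> Y \<Longrightarrow> h i y \<in> Y'"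
    and P: "\<And>l. l \<in> set P \<Longrightarrow> reversible_layer W l" "P \<noteq> []" "0 < W"
    and vars: "fst ` set P \<subseteq> I" "\<And>i. i \<in> fst ` set P \<Longrightarrow> GH X' Y' (f i) > 0"
    and run: "\<And>x y. x \<in> X \<Longrightarrow> y \<in> Y \<Longrightarrow>
      run (\<lambda>i. f i (g i x) (h i y)) P 0 = (if F x y then Accept else Reject)"
  shows "GH X Y F \<le> 18 * W * cost (\<lambda>i. GH X' Y' (f i)) P"
proof -
  interpret program_network P W by unfold_locales (rule P(1))
  have "\<exists>V t (a :: 'x' \<Rightarrow> nat \<Rightarrow> nat) (b :: 'y' \<Rightarrow> nat \<Rightarrow> nat). finite V \<and> t \<notin> V \<and> card V = GH X' Y' (f i) \<and>
      (\<forall>x\<in>X'. matching_map (insert t V) (a x)) \<and> (\<forall>y\<in>Y'. matching_map V (b y)) \<and>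
      (\<forall>x\<in>X'. \<forall>y\<in>Y'. outputs (a x) (b y) t (f i x y))" for i
    by (rule ex_optimal_protocol[OF fin])
  then obtain V t and a :: "'i \<Rightarrow> 'x' \<Rightarrow> nat \<Rightarrow> nat" and b :: "'i \<Rightarrow> 'y' \<Rightarrow> nat \<Rightarrow> nat"
    where p: "\<And>i. finite (V i)" "\<And>i. t i \<notin> V i" "\<And>i. card (V i) = GH X' Y' (f i)"
      "\<And>i x. x \<in> X' \<Longrightarrow> matching_map (insert (t i) (V i)) (a i x)"
      "\<And>i y. y \<in> Y' \<Longrightarrow> matching_map (V i) (b i y)"
      "\<And>i x y. x \<in> X' \<Longrightarrow> y \<in> Y' \<Longrightarrow> outputs (a i x) (b i y) (t i) (f i x y)"
    by metis
  define lab :: "nat \<times> bool \<times> nat \<Rightarrow> 'i" where "lab = (\<lambda>q. var (fst q))"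
  have lab: "lab q \<in> fst ` set P" if "q \<in> switches" for q
    using that by (auto simp: lab_def switches_def)
  have labI: "lab q \<in> I" if "q \<in> switches" for q using lab[OF that] vars by auto
  interpret N: switch_network X Y switches lab linkage V t "\<lambda>i x. a i (g i x)" "\<lambda>i y. b i (h i y)"
    "\<lambda>i x y. f i (g i x) (h i y)"
  proof unfold_locales
    show "finite switches" by (simp add: switches_def)
    show "matching_map (switches \<times> {..<6}) linkage"
      unfolding linkage_def by (rule matching_map_mate[OF is_matching_linkage])
  qed (use p g h labI in auto)
  have "GH X Y F \<le> (\<Sum>q\<in>switches. 3 * card (V (lab q)) + 6)"
  proof (rule N.GH_le_network)
    show "(0, True, 0) \<in> switches" using P by (simp add: switches_def)
    show "linkage ((0, True, 0), 0) = ((0, True, 0), 0)" by (rule linkage_start)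
    show "routed (\<lambda>q. f (lab q) (g (lab q) x) (h (lab q) y)) linkage ((0, True, 0), 0) (F x y)"
      if "x \<in> X" "y \<in> Y" for x y
      using routed_run[of 0 0 "\<lambda>i. f i (g i x) (h i y)" _] run[OF that] P(3)
      by (auto simp: lab_def split: if_splits)
  qed
  also have "\<dots> \<le> (\<Sum>q\<in>switches. 9 * GH X' Y' (f (lab q)))"
  proof (rule sum_mono)
    fix q assume "q \<in> switches"
    then have "GH X' Y' (f (lab q)) > 0" using lab vars(2) by blast
    then show "3 * card (V (lab q)) + 6 \<le> 9 * GH X' Y' (f (lab q))" by (simp add: p(3))
  qed
  also have "\<dots> = (\<Sum>l<length P. \<Sum>q\<in>(UNIV :: bool set) \<times> {..<W}. 9 * GH X' Y' (f (var l)))"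
    unfolding switches_def by (simp add: sum.cartesian_product' lab_def)
  also have "\<dots> = 18 * W * (\<Sum>l<length P. GH X' Y' (f (var l)))"
    by (simp add: card_cartesian_product sum_distrib_left algebra_simps)
  also have "(\<Sum>l<length P. GH X' Y' (f (var l))) = cost (\<lambda>i. GH X' Y' (f i)) P"
    by (simp add: cost_def sum_list_sum_nth atLeast0LessThan case_prod_beta)
  finally show ?thesis .
qed

section \<open>Building blocks of programs\<close>

lemma reversible_layerI:
  assumes "p permutes {..<W}" "\<And>s u. s < W \<Longrightarrow> e s = Go u \<Longrightarrow> u < W"
    and "\<And>r s u. r < W \<Longrightarrow> s < W \<Longrightarrow> e r = Go u \<Longrightarrow> e s = Go u \<Longrightarrow> r = s"
  shows "reversible_layer W (i, p, e)"
  using assms unfolding reversible_layer.simps by blast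

lemma reversible_layerD:
  assumes "reversible_layer W (i, p, e)"
  shows "p permutes {..<W}" "s < W \<Longrightarrow> e s = Go u \<Longrightarrow> u < W"
    and "r < W \<Longrightarrow> s < W \<Longrightarrow> e r = Go u \<Longrightarrow> e s = Go u \<Longrightarrow> r = s"
  using assms unfolding reversible_layer.simps by blast+

declare reversible_layer.simps [simp del]

lemma run_append:
  "run z (P @ Q) s = (case run z P s of Go u \<Rightarrow> run z Q u | Accept \<Rightarrow> Accept | Reject \<Rightarrow> Reject)"
  by (induction z P s rule: run.induct) (auto split: outcome.splits)

lemma cost_append: "cost w (P @ Q) = cost w P + cost w Q"
  by (simp add: cost_def)

lemma cost_map: "cost w (map (\<lambda>i. (i, p, e)) xs) = sum_list (map w xs)"
  by (simp add: cost_def comp_def)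

text \<open>For changes of state that do not depend on the input; \<open>i\<close> decides from
  which protocol the switches of the layer are built.\<close>

definition static :: "'i \<Rightarrow> (nat \<Rightarrow> outcome) \<Rightarrow> 'i layer" where
  "static i e = (i, id, e)"

lemma run_static [simp]:
  "run z (static i e # P) s = (case e s of Go u \<Rightarrow> run z P u | Accept \<Rightarrow> Accept | Reject \<Rightarrow> Reject)"
  by (simp add: static_def)

lemma fst_static [simp]: "fst (static i e) = i"
  by (simp add: static_def)

lemma cost_static: "cost w (static i e # P) = w i + cost w P"
  by (simp add: static_def cost_def)

lemma reversible_static:
  assumes "\<And>s u. s < W \<Longrightarrow> e s = Go u \<Longrightarrow> u < W"
    and "\<And>r s u. r < W \<Longrightarrow> s < W \<Longrightarrow> e r = Go u \<Longrightarrow> e s = Go u \<Longrightarrow> r = s"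
  shows "reversible_layer W (static i e)"
  unfolding static_def by (rule reversible_layerI[OF permutes_id]) (fact assms)+

text \<open>States from \<open>G\<close> on stay in place, so that grids of different sizes fit into
  one width.\<close>

definition cyclic_shift :: "nat \<Rightarrow> nat \<Rightarrow> nat \<Rightarrow> nat" where
  "cyclic_shift G d s = (if s < G then (s + d) mod G else s)"

lemma cyclic_shift_permutes:
  assumes "G \<le> W"
  shows "cyclic_shift G d permutes {..<W}"
proof (rule bij_imp_permutes)
  show "cyclic_shift G d x = x" if "x \<notin> {..<W}" for x
    using that assms by (simp add: cyclic_shift_def)
  have "inj_on (cyclic_shift G d) {..<W}"
  proof (rule inj_onI)
    fix r s assume "r \<in> {..<W}" "s \<in> {..<W}" and eq: "cyclic_shift G d r = cyclic_shift G d s"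
    show "r = s"
    proof (cases "r < G \<and> s < G")
      case True
      then have eq': "(r + d) mod G = (s + d) mod G" using eq by (simp add: cyclic_shift_def)
      have "v = u" if "u \<le> v" "v < G" "(v + d) mod G = (u + d) mod G" for u v
      proof -
        have "G dvd v - u" using that mod_eq_dvd_iff_nat[of "u + d" "v + d" G] by simp
        then show ?thesis using that by (metis dvd_imp_le diff_is_0_eq' le_antisym less_imp_diff_less not_le zero_less_diff)
      qed
      then show ?thesis using True eq' by (metis linear)
    next
      case False
      have "(x + d) mod G < G" if "x < G" for x using that by simp
      then show ?thesis using eq False by (auto simp: cyclic_shift_def split: if_splits)
    qed
  qed
  moreover have "cyclic_shift G d ` {..<W} \<subseteq> {..<W}"
    using assms by (auto simp: cyclic_shift_def intro: less_le_trans[OF mod_less_divisor])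
  ultimately show "bij_betw (cyclic_shift G d) {..<W} {..<W}"
    by (simp add: bij_betw_def endo_inj_surj)
qed

definition counter :: "nat \<Rightarrow> nat \<Rightarrow> 'i list \<Rightarrow> 'i layer list" where
  "counter G d = map (\<lambda>i. (i, cyclic_shift G d, Go))"

lemma run_counter:
  "s < G \<Longrightarrow> run z (counter G d xs) s = Go ((s + d * length (filter z xs)) mod G)"
proof (induction xs arbitrary: s)
  case (Cons i xs)
  then have "(s + d) mod G < G" by simp
  then show ?case using Cons by (simp add: counter_def cyclic_shift_def mod_simps algebra_simps)
qed (simp add: counter_def)

lemma reversible_counter:
  "G \<le> W \<Longrightarrow> l \<in> set (counter G d xs) \<Longrightarrow> reversible_layer W l"
  by (auto simp: counter_def intro!: reversible_layerI cyclic_shift_permutes)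

lemma cost_counter: "cost w (counter G d xs) = sum_list (map w xs)"
  by (simp add: counter_def cost_map)

text \<open>\<open>Reject\<close> is a filler for states that \<open>e\<close> never produces;
  undoing a run does not meet them.\<close>

definition exit_inverse :: "nat \<Rightarrow> (nat \<Rightarrow> outcome) \<Rightarrow> nat \<Rightarrow> outcome" where
  "exit_inverse W e u = (if \<exists>s<W. e s = Go u then Go (THE s. s < W \<and> e s = Go u) else Reject)"

text \<open>A layer permutes first and exits afterwards. Its inverse has to work in the opposite
  order, which takes two layers and doubles the cost.\<close>

fun inverse_program :: "nat \<Rightarrow> 'i layer list \<Rightarrow> 'i layer list" where
  "inverse_program W [] = []"
| "inverse_program W ((i, p, e) # P) = inverse_program W P @ [(i, id, exit_inverse W e), (i, inv p, Go)]"

lemma exit_inverse_eq: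
  assumes "reversible_layer W (i, p, e)" "s < W" "e s = Go u"
  shows "exit_inverse W e u = Go s"
proof -
  have "(THE s. s < W \<and> e s = Go u) = s"
    using assms reversible_layerD(3)[OF assms(1)] by (intro the_equality) blast+
  then show ?thesis using assms by (auto simp: exit_inverse_def)
qed

lemma exit_inverse_GoD:
  assumes "reversible_layer W (i, p, e)" "exit_inverse W e u = Go s"
  shows "s < W" "e s = Go u"
proof -
  obtain r where r: "r < W" "e r = Go u" using assms(2) by (auto simp: exit_inverse_def split: if_splits)
  then have "r = s" using exit_inverse_eq[OF assms(1) r] assms(2) by simp
  then show "s < W" "e s = Go u" using r by auto
qed

lemma run_inverse:
  assumes "\<forall>l\<in>set P. reversible_layer W l" "s < W" "run z P s = Go u"
  shows "run z (inverse_program W P) u = Go s"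
  using assms
proof (induction z P s rule: run.induct)
  case (2 z i p e P s)
  note IH = "2.IH" and prems = "2.prems"
  let ?s = "if z i then p s else s"
  have l: "reversible_layer W (i, p, e)" using prems by simp
  then have p: "p permutes {..<W}" by (rule reversible_layerD)
  then have s: "?s < W" using prems(2) permutes_in_image[OF p, of s] by auto
  obtain v where v: "e ?s = Go v" "run z P v = Go u"
    using prems(3) by (auto split: outcome.splits)
  have "v < W" using reversible_layerD(2)[OF l s v(1)] .
  then have "run z (inverse_program W P) u = Go v"
    using IH[OF v(1)] prems(1) v by simp
  then show ?case
    using exit_inverse_eq[OF l s v(1)] permutes_inverses(2)[OF p] by (simp add: run_append)
qed simp

lemma reversible_inverse:
  "\<forall>l\<in>set P. reversible_layer W l \<Longrightarrow> l \<in> set (inverse_program W P) \<Longrightarrow> reversible_layer W l"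
proof (induction W P rule: inverse_program.induct)
  case (2 W i p e P)
  have l: "reversible_layer W (i, p, e)" using 2 by simp
  have "reversible_layer W (i, id, exit_inverse W e)"
  proof (rule reversible_layerI)
    show "r = s" if "exit_inverse W e r = Go u" "exit_inverse W e s = Go u" for r s u
      using exit_inverse_GoD(2)[OF l that(1)] exit_inverse_GoD(2)[OF l that(2)] by simp
    show "u < W" if "exit_inverse W e s = Go u" for s u
      using exit_inverse_GoD(1)[OF l that] .
  qed (rule permutes_id)
  moreover have "reversible_layer W (i, inv p, Go)"
    using reversible_layerD(1)[OF l] by (auto intro!: reversible_layerI permutes_inv)
  ultimately show ?case using 2 by auto
qed simp

lemma cost_inverse: "cost w (inverse_program W P) = 2 * cost w P"
  by (induction W P rule: inverse_program.induct) (simp_all add: cost_append, simp_all add: cost_def)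

lemma fst_set_inverse: "fst ` set (inverse_program W P) = fst ` set P"
  by (induction W P rule: inverse_program.induct) auto

section \<open>Thresholds\<close>

text \<open>The left-hand side is the Beta function at \<open>(n + 1, m)\<close>, and the recursion used is that of Leibniz' harmonic triangle.\<close>

lemma beta_fraction_sum:
  assumes "m > 0"
  shows "\<exists>u :: nat \<Rightarrow> int. fact n * fact (m - 1) / fact (n + m) = (\<Sum>i=m..m+n. real_of_int (u i) / real i)"
  using assms
proof (induction n arbitrary: m)
  case 0
  obtain k where "m = Suc k" using 0 by (cases m) auto
  then show ?case by (intro exI[of _ "\<lambda>_. 1"]) (simp add: divide_simps)
next
  case (Suc n)
  obtain k where k: "m = Suc k" using Suc.prems by (cases m) auto
  obtain u where u: "fact n * fact (m - 1) / fact (n + m) = (\<Sum>i=m..m+n. real_of_int (u i) / real i)"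
    using Suc by blast
  obtain v where v: "fact n * fact (Suc m - 1) / fact (n + Suc m) = (\<Sum>i=Suc m..Suc m+n. real_of_int (v i) / real i)"
    using Suc.IH[of "Suc m"] by auto
  define w where "w i = (if i \<le> m + n then u i else 0) - (if m < i then v i else 0)" for i
  \<comment> \<open>In terms of the Beta function: B(n + 2, m) = B(n + 1, m) - B(n + 1, m +
    1).\<close>
  have "fact (Suc n) * fact (m - 1) / fact (Suc n + m) =
      (fact n * fact (m - 1) / fact (n + m) - fact n * fact (Suc m - 1) / fact (n + Suc m) :: real)"
  proof -
    have "(x + 1) * A / ((x + y + 2) * ((x + y + 1) * F)) =
        A / ((x + y + 1) * F) - (y + 1) * A / ((x + y + 2) * ((x + y + 1) * F))"
      if "x \<ge> 0" "y \<ge> 0" "F > 0" for x y A F :: real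
    proof -
      have "x + y + 1 \<noteq> 0" "x + y + 2 \<noteq> 0" using that by linarith+
      then have "A / ((x + y + 1) * F) = (x + y + 2) * A / ((x + y + 2) * ((x + y + 1) * F))" by simp
      then show ?thesis by (simp add: diff_divide_distrib[symmetric] algebra_simps)
    qed
    from this[of "real n" "real k" "fact (n + k)" "fact n * fact k"]
    show ?thesis by (simp add: k algebra_simps)
  qed
  also have "\<dots> = (\<Sum>i=m..m + Suc n. real_of_int (if i \<le> m + n then u i else 0) / real i)
      - (\<Sum>i=m..m + Suc n. real_of_int (if m < i then v i else 0) / real i)"
  proof -
    have "(\<Sum>i=m..m + Suc n. real_of_int (if i \<le> m + n then u i else 0) / real i) =
        (\<Sum>i=m..m+n. real_of_int (u i) / real i)"
      by (rule sum.mono_neutral_cong_right) auto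
    moreover have "(\<Sum>i=m..m + Suc n. real_of_int (if m < i then v i else 0) / real i) =
        (\<Sum>i=Suc m..Suc m+n. real_of_int (v i) / real i)"
      by (rule sum.mono_neutral_cong_right) auto
    ultimately show ?thesis using u v by simp
  qed
  also have "\<dots> = (\<Sum>i=m..m + Suc n. real_of_int (w i) / real i)"
    unfolding w_def by (subst sum_subtractf[symmetric]) (simp add: diff_divide_distrib)
  finally show ?case by blast
qed

text \<open>The central binomial coefficient is at least \<open>2 ^ n\<close>. This makes the Beta
  fraction with \<open>m = n\<close> as small as \<open>1 / 2 ^ n\<close>.\<close>

lemma fact_double_ge: "2 ^ n * (fact n * fact n) \<le> (fact (2 * n) :: real)"
proof (induction n)
  case (Suc n)
  have "2 ^ Suc n * (fact (Suc n) * fact (Suc n)) = (2 * (real n + 1)^2) * (2 ^ n * (fact n * fact n))"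
    by (simp add: power2_eq_square algebra_simps)
  also have "\<dots> \<le> ((2 * real n + 2) * (2 * real n + 1)) * fact (2 * n)"
    by (rule mult_mono[OF _ Suc]) (simp_all add: power2_eq_square algebra_simps)
  also have "\<dots> = fact (2 * Suc n)"
    by (simp add: algebra_simps)
  finally show ?case .
qed simp

text \<open>The Beta fraction \<open>d\<close> is at most \<open>r\<close>, so its largest multiple
  up to \<open>2 * r\<close> is at least \<open>r\<close>. Reducing the numerators modulo their
  denominators makes them nonnegative and changes the sum by an integer only.\<close>

lemma ex_small_fraction_sum:
  fixes r :: real
  assumes "n > 0" "0 < r" "1 \<le> 2 ^ n * r"
  shows "\<exists>(c :: nat \<Rightarrow> nat) (q :: int) a. r \<le> a \<and> a \<le> 2 * r \<and>
    (\<Sum>m\<in>{n..2 * n}. real (c m) / real m) = a + of_int q"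
proof -
  define d :: real where "d = fact n * fact (n - 1) / fact (n + n)"
  obtain u where u: "d = (\<Sum>i=n..n+n. real_of_int (u i) / real i)"
    using beta_fraction_sum[OF assms(1), of n] unfolding d_def by blast
  have "fact (n - 1) \<le> (fact n :: real)" by (rule fact_mono) simp
  then have "2 ^ n * d \<le> 2 ^ n * (fact n * fact n) / fact (n + n)"
    unfolding d_def by (simp add: divide_simps mult_left_mono)
  also have "\<dots> \<le> 1" using fact_double_ge[of n] by (simp add: mult_2 divide_simps)
  finally have "2 ^ n * d \<le> 2 ^ n * r" using assms by linarith
  then have "d \<le> r" by simp
  moreover have "0 < d" by (simp add: d_def)
  ultimately have d: "0 < d" "d \<le> r" by blast+
  define k where "k = \<lfloor>2 * r / d\<rfloor>"
  have "of_int k \<le> 2 * r / d" "2 * r / d < of_int k + 1" by (simp_all add: k_def)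
  then have "of_int k * d \<le> 2 * r" "2 * r < of_int k * d + d"
    using d by (simp_all add: field_simps)
  then have a: "r \<le> of_int k * d" "of_int k * d \<le> 2 * r" using d by auto
  define c where "c m = nat ((k * u m) mod int m)" for m
  define w where "w m = - ((k * u m) div int m)" for m
  have c: "real (c m) / real m = of_int k * (of_int (u m) / of_nat m) + of_int (w m)"
    if "m \<in> {n..2 * n}" for m
  proof -
    have m: "int m > 0" using that assms(1) by auto
    have "int (c m) = k * u m - int m * ((k * u m) div int m)"
      using m by (simp add: c_def minus_mult_div_eq_mod)
    then have "real (c m) = of_int k * of_int (u m) - real m * of_int ((k * u m) div int m)"
      by (metis of_int_diff of_int_mult of_int_of_nat_eq)
    then show ?thesis using m by (simp add: w_def field_simps)
  qed
  have "(\<Sum>m\<in>{n..2 * n}. real (c m) / real m) =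
      of_int k * d + of_int (\<Sum>m\<in>{n..2 * n}. w m)"
    using c by (simp add: sum.distrib u sum_distrib_left mult_2)
  then show ?thesis using a by blast
qed

text \<open>The point \<open>s\<close> of the cyclic grid with \<open>G\<close> points approximates \<open>a\<close> modulo 1 from below.\<close>

definition near :: "nat \<Rightarrow> nat \<Rightarrow> real \<Rightarrow> real \<Rightarrow> bool" where
  "near G s a e \<longleftrightarrow> s < G \<and> (\<exists>q :: int. real s / real G \<le> a + q \<and> a + q \<le> real s / real G + e)"

section \<open>Approximation on cyclic grids\<close>

lemma near_shift_int:
  assumes "near G s a e"
  shows "near G s (a + of_int j) e"
proof -
  obtain q :: int where "s < G" "real s / real G \<le> a + q" "a + q \<le> real s / real G + e"
    using assms by (auto simp: near_def)
  then show ?thesis unfolding near_def by (intro conjI exI[of _ "q - j"]) auto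
qed

lemma ex_near:
  assumes "G > 0"
  shows "\<exists>s. near G s a (1 / real G)"
proof -
  define s where "s = nat \<lfloor>frac a * real G\<rfloor>"
  have f: "0 \<le> frac a * real G" "frac a * real G < real G"
    using frac_ge_0[of a] frac_lt_1[of a] assms by auto
  then have s: "real s \<le> frac a * real G" "frac a * real G < real s + 1"
    unfolding s_def by linarith+
  have "real s / real G \<le> frac a" "frac a \<le> real s / real G + 1 / real G"
    using s assms by (simp_all add: field_simps)
  then show ?thesis unfolding near_def
    using s f by (intro exI[of _ s] conjI exI[of _ "- \<lfloor>a\<rfloor>"]) (auto simp: frac_def)
qed

text \<open>The rotation by \<open>d / G\<close> is exact, and wrapping around is absorbed by the
  integer \<open>q\<close>; hence \<open>e\<close> does not grow.\<close>

lemma near_cyclic_shift: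
  assumes "near G s a e"
  shows "near G ((s + d) mod G) (a + real d / real G) e"
proof -
  obtain q :: int where q: "s < G" "real s / real G \<le> a + q" "a + q \<le> real s / real G + e"
    using assms by (auto simp: near_def)
  have "real (s + d) = real ((s + d) mod G) + real G * real ((s + d) div G)"
    by (metis mod_mult_div_eq of_nat_add of_nat_mult)
  then have "real ((s + d) mod G) / real G = real s / real G + real d / real G - real ((s + d) div G)"
    using q(1) by (simp add: field_simps)
  then show ?thesis unfolding near_def
    using q by (intro conjI exI[of _ "q - int ((s + d) div G)"]) auto
qed

text \<open>Rounding down moves the point by at most one cell of the new grid, which is the
  additional error.\<close>

lemma near_rescale:
  assumes "near G s a e" "G \<le> G'"
  shows "near G' (s * G' div G) a (e + 1 / real G')"
proof -
  obtain q :: int where q: "s < G" "real s / real G \<le> a + q" "a + q \<le> real s / real G + e"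
    using assms by (auto simp: near_def)
  have G: "G > 0" "G' > 0" using q assms by auto
  let ?s = "s * G' div G"
  have "?s * G \<le> s * G'" "s * G' < (?s + 1) * G"
    using G by (simp_all, metis dividend_less_div_times add.commute mult.commute mult_Suc)
  then have "real ?s * real G \<le> real s * real G'" "real s * real G' \<le> (real ?s + 1) * real G"
    by (metis of_nat_le_iff of_nat_mult, metis less_imp_le of_nat_1 of_nat_add of_nat_le_iff of_nat_mult)
  then have "real ?s / real G' \<le> real s / real G" "real s / real G \<le> real ?s / real G' + 1 / real G'"
    using G by (simp_all add: field_simps)
  moreover have "?s < G'"
    using q(1) G by (simp add: div_less_iff_less_mult)
  ultimately show ?thesis unfolding near_def
    using q by (intro conjI exI[of _ q]) auto
qed

section \<open>Adding fractions on growing grids\<close>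

definition rescale :: "nat \<Rightarrow> nat \<Rightarrow> nat \<Rightarrow> outcome" where
  "rescale G G' s = (if s < G then Go (s * G' div G) else Reject)"

text \<open>Distinct points of the old grid are at least one cell of the new grid apart, so rounding
  down does not merge them.\<close>

lemma reversible_rescale:
  assumes "0 < G" "G \<le> G'" "G' \<le> W"
  shows "reversible_layer W (static i (rescale G G'))"
proof (rule reversible_static)
  show "u < W" if "rescale G G' s = Go u" for s u
  proof -
    have "s < G" "u = s * G' div G" using that by (auto simp: rescale_def split: if_splits)
    then have "u < G'" using assms by (simp add: div_less_iff_less_mult)
    then show ?thesis using assms by simp
  qed
  have lt: "r * G' div G < s * G' div G" if "r < s" for r s
  proof -
    have "r * G' + G \<le> s * G'"
      using that assms(2) by (metis Suc_leI add.commute add_left_mono mult_Suc mult_le_mono1 order_trans)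
    then have "(r * G' + G) div G \<le> s * G' div G" by (rule div_le_mono)
    then show ?thesis using assms(1) by simp
  qed
  show "r = s" if "rescale G G' r = Go u" "rescale G G' s = Go u" for r s u
  proof (rule ccontr)
    assume "r \<noteq> s"
    then consider "r < s" | "s < r" by linarith
    then show False using lt[of r s] lt[of s r] that by cases (auto simp: rescale_def split: if_splits)
  qed
qed

text \<open>The grid size is a multiple of \<open>m\<close>, so that adding \<open>c m / m\<close> causes no error, and grows
  with \<open>m\<close>, so that rounding to the next grid is injective. The factor 96 keeps the sum of all
  rounding errors below 1/32.\<close>

definition stage :: "'i list \<Rightarrow> (nat \<Rightarrow> nat) \<Rightarrow> nat \<Rightarrow> 'i layer list" where
  "stage xs c m = counter (96 * m) (96 * c m) xs @ [static (hd xs) (rescale (96 * m) (96 * Suc m))]"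

lemma run_stage:
  assumes "near (96 * m) s a e" "m > 0"
  shows "\<exists>u. run z (stage xs c m) s = Go u \<and>
    near (96 * Suc m) u (a + real (length (filter z xs)) * (real (c m) / real m)) (e + 1 / real (96 * Suc m))"
proof -
  let ?n = "length (filter z xs)"
  let ?u = "(s + 96 * c m * ?n) mod (96 * m)"
  have s: "s < 96 * m" using assms(1) by (simp add: near_def)
  have u: "near (96 * m) ?u (a + real ?n * (real (c m) / real m)) e"
    using near_cyclic_shift[OF assms(1), of "96 * c m * ?n"] assms(2) by (simp add: mult.commute)
  then have "?u < 96 * m" by (simp add: near_def)
  then show ?thesis
    unfolding stage_def using near_rescale[OF u, of "96 * Suc m"] run_counter[OF s, of z "96 * c m" xs]
    by (simp add: run_append rescale_def)
qed

lemma run_stages: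
  assumes "near (96 * n) s a e" "n > 0"
  shows "\<exists>u. run z (concat (map (stage xs c) [n..<n + j])) s = Go u \<and>
    near (96 * (n + j)) u (a + real (length (filter z xs)) * (\<Sum>m\<in>{n..<n + j}. real (c m) / real m))
      (e + real j / real (96 * n))"
proof (induction j)
  case 0
  then show ?case using assms by simp
next
  case (Suc j)
  then obtain u where u: "run z (concat (map (stage xs c) [n..<n + j])) s = Go u"
    "near (96 * (n + j)) u (a + real (length (filter z xs)) * (\<Sum>m\<in>{n..<n + j}. real (c m) / real m))
      (e + real j / real (96 * n))" by blast
  obtain v where v: "run z (stage xs c (n + j)) u = Go v"
    "near (96 * Suc (n + j)) v (a + real (length (filter z xs)) * (\<Sum>m\<in>{n..<n + j}. real (c m) / real m)
       + real (length (filter z xs)) * (real (c (n + j)) / real (n + j)))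
      (e + real j / real (96 * n) + 1 / real (96 * Suc (n + j)))"
    using run_stage[OF u(2), of z xs c] assms(2) by blast
  \<comment> \<open>Every later grid is finer than the first one, so each rounding error is bounded
    by a cell of the first grid.\<close>
  have "1 / real (96 * Suc (n + j)) \<le> 1 / real (96 * n)"
    using assms(2) by (intro divide_left_mono) auto
  then have "e + real j / real (96 * n) + 1 / real (96 * Suc (n + j)) \<le> e + real (Suc j) / real (96 * n)"
    by (simp add: add_divide_distrib)
  then have "near (96 * (n + Suc j)) v
      (a + real (length (filter z xs)) * (\<Sum>m\<in>{n..<n + Suc j}. real (c m) / real m))
      (e + real (Suc j) / real (96 * n))"
    using v(2) by (fastforce simp: near_def algebra_simps)
  then show ?case using u(1) v(1) by (auto simp: run_append)
qed

section \<open>Reading off the sign of the deviation\<close>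

definition decide :: "nat \<Rightarrow> nat \<Rightarrow> outcome" where
  "decide G s = (if 2 * s < G then Accept else if 16 * s < 15 * G then Reject else Go s)"

text \<open>\<open>a * D\<close> lies between -1/4 and 1/4, and the point falls short of it modulo 1
  by at most 1/32. A point in the lower half of the circle thus reveals \<open>D > 0\<close>, and
  one between 1/2 and 15/16 reveals \<open>D < 0\<close>. The last sixteenth also contains small
  positive values that were rounded to below 0, but there \<open>a * D\<close> has absolute value at
  most 1/16, which the lower bound on \<open>a\<close> turns into \<open>B / 2\<close> for
  \<open>D\<close>.\<close>

lemma decide_near:
  fixes a D B :: real
  assumes "near G s (a * D) (1 / 32)" "0 < B" "1 / (8 * B) \<le> a" "a \<le> 1 / (4 * B)" "\<bar>D\<bar> \<le> B" "D \<noteq> 0"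
  shows "decide G s = Accept \<and> 0 < D \<or> decide G s = Reject \<and> D < 0 \<or> decide G s = Go s \<and> \<bar>D\<bar> \<le> B / 2"
proof -
  define v where "v = real s / real G"
  obtain q :: int where q: "s < G" "v \<le> a * D + q" "a * D + q \<le> v + 1 / 32"
    using assms(1) by (auto simp: near_def v_def)
  have a: "a > 0" using assms by (meson divide_pos_pos less_le_trans mult_pos_pos zero_less_numeral zero_less_one)
  have "\<bar>a * D\<bar> \<le> 1 / (4 * B) * B"
    unfolding abs_mult using a assms by (intro mult_mono) auto
  then have aD: "\<bar>a * D\<bar> \<le> 1 / 4" using assms(2) by simp
  have v: "0 \<le> v" "v < 1" "2 * s < G \<longleftrightarrow> v < 1 / 2" "16 * s < 15 * G \<longleftrightarrow> v < 15 / 16"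
    using q(1) by (auto simp: v_def field_simps)
  \<comment> \<open>In each range of \<open>v\<close> only one integer \<open>q\<close> is
    compatible with the bound 1/4.\<close>
  consider "v < 1 / 2" | "1 / 2 \<le> v" "v < 15 / 16" | "15 / 16 \<le> v" by linarith
  then show ?thesis
  proof cases
    case 1
    then have "q = 0" using q aD v by linarith
    then have "0 \<le> a * D" using q v by simp
    then show ?thesis using 1 v a assms(6) by (auto simp: decide_def zero_le_mult_iff)
  next
    case 2
    then have "q = 1" using q aD v by linarith
    then have "a * D < 0" using q v 2 by simp
    then show ?thesis using 2 v a by (auto simp: decide_def mult_less_0_iff)
  next
    case 3
    then have "q = 1" using q aD v by linarith
    then have "\<bar>a * D\<bar> \<le> 1 / 16" using q v 3 by (simp add: abs_le_iff)
    then have "a * \<bar>D\<bar> \<le> 1 / 16" using a by (simp add: abs_mult)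
    moreover have "1 / (8 * B) * \<bar>D\<bar> \<le> a * \<bar>D\<bar>" by (rule mult_right_mono[OF assms(3)]) simp
    ultimately have "1 / (8 * B) * \<bar>D\<bar> \<le> 1 / 16" by linarith
    then have "\<bar>D\<bar> \<le> B / 2" using assms(2) by (simp add: field_simps)
    then show ?thesis using 3 v by (simp add: decide_def)
  qed
qed

lemma near_mono: "near G s a e \<Longrightarrow> e \<le> e' \<Longrightarrow> near G s a e'"
  unfolding near_def by force

lemma cost_stages:
  assumes "w (hd xs) \<le> sum_list (map w xs)"
  shows "cost w (concat (map (stage xs c) ms)) \<le> 2 * length ms * sum_list (map w xs)"
proof (induction ms)
  case (Cons m ms)
  have "cost w (stage xs c m) \<le> 2 * sum_list (map w xs)"
    using assms by (simp add: stage_def cost_append cost_counter cost_static cost_def[of _ "[]"])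
  then show ?case using Cons by (simp add: cost_append)
qed (simp add: cost_def)

text \<open>\<open>F\<close> brings the state near \<open>a * D\<close> modulo 1,
  \<open>decide\<close> inspects it, and the inverse of \<open>F\<close> restores state 0 if the
  sign is still open, so that another program can follow. The width is the size of the last
  grid.\<close>

lemma ex_level:
  fixes B \<theta> :: real and xs :: "'i list"
  assumes "xs \<noteq> []" "n > 0" "0 < B" "8 * B \<le> 2 ^ n"
  defines "W \<equiv> 96 * (n + (n + 1))"
  shows "\<exists>P. (\<forall>l\<in>set P. reversible_layer W l) \<and> fst ` set P \<subseteq> set xs \<and>
    (\<forall>w. cost w P \<le> (6 * n + 10) * sum_list (map w xs)) \<and>
    (\<forall>z D. D = real (length (filter z xs)) - \<theta> \<longrightarrow> \<bar>D\<bar> \<le> B \<longrightarrow> D \<noteq> 0 \<longrightarrow>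
      run z P 0 = Accept \<and> 0 < D \<or> run z P 0 = Reject \<and> D < 0 \<or> run z P 0 = Go 0 \<and> \<bar>D\<bar> \<le> B / 2)"
proof -
  \<comment> \<open>The interval from \<open>1 / (8 * B)\<close> to \<open>1 / (4 * B)\<close> is
    the one that \<open>decide_near\<close> requires.\<close>
  obtain c :: "nat \<Rightarrow> nat" and q :: int and a :: real
    where a: "1 / (8 * B) \<le> a" "a \<le> 2 * (1 / (8 * B))"
      and c: "(\<Sum>m\<in>{n..2 * n}. real (c m) / real m) = a + of_int q"
    using ex_small_fraction_sum[of n "1 / (8 * B)"] assms(2-4) by (auto simp: field_simps)
  \<comment> \<open>The start accounts for the threshold: counting the true variables from here
    yields \<open>a * D\<close> instead of a multiple of their number.\<close>
  obtain s0 where s0: "near (96 * n) s0 (- a * \<theta>) (1 / real (96 * n))"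
    using ex_near[of "96 * n"] assms(2) by auto
  define i where "i = hd xs"
  have i: "i \<in> set xs" using assms(1) by (simp add: i_def)
  define F where "F = static i (\<lambda>s. if s = 0 then Go s0 else Reject) # concat (map (stage xs c) [n..<n + (n + 1)])"
  define P where "P = F @ static i (decide W) # inverse_program W F"
  have s0W: "s0 < W" using s0 by (simp add: near_def W_def)
  have revF: "reversible_layer W l" if "l \<in> set F" for l
  proof -
    have "l = static i (\<lambda>s. if s = 0 then Go s0 else Reject) \<or>
        (\<exists>m\<in>{n..<n + (n + 1)}. l \<in> set (stage xs c m))"
      using that unfolding F_def by auto
    then show ?thesis
    proof (elim disjE bexE)
      assume "l = static i (\<lambda>s. if s = 0 then Go s0 else Reject)"
      then show ?thesis
        using s0W by (auto intro!: reversible_static split: if_splits)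
    next
      fix m assume m: "m \<in> {n..<n + (n + 1)}" and "l \<in> set (stage xs c m)"
      then consider "l \<in> set (counter (96 * m) (96 * c m) xs)"
        | "l = static (hd xs) (rescale (96 * m) (96 * Suc m))"
        unfolding stage_def by auto
      then show ?thesis
      proof cases
        case 1
        then show ?thesis using m by (intro reversible_counter[OF _ 1]) (simp add: W_def)
      next
        case 2
        show ?thesis unfolding 2 by (rule reversible_rescale) (use m assms(2) in \<open>auto simp: W_def\<close>)
      qed
    qed
  qed
  have rev: "reversible_layer W l" if "l \<in> set P" for l
  proof -
    have "reversible_layer W (static i (decide W))"
      by (rule reversible_static) (auto simp: decide_def split: if_splits)
    moreover have "l \<in> set F \<or> l = static i (decide W) \<or> l \<in> set (inverse_program W F)"
      using that by (auto simp: P_def)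
    ultimately show ?thesis using revF reversible_inverse[of F W] by blast
  qed
  have varF: "fst ` set F \<subseteq> set xs"
    using i by (auto simp: F_def stage_def counter_def i_def)
  have var: "fst ` set P \<subseteq> set xs"
    using varF i by (auto simp: P_def image_Un fst_set_inverse)
  have cost: "cost w P \<le> (6 * n + 10) * sum_list (map w xs)" for w
  proof -
    let ?T = "sum_list (map w xs)"
    have wi: "w i \<le> ?T" using i by (intro member_le_sum_list) auto
    have "cost w F \<le> w i + 2 * (n + 1) * ?T"
      unfolding F_def cost_static using cost_stages[of w xs c "[n..<n + (n + 1)]"] wi by (simp add: i_def)
    \<comment> \<open>\<open>F\<close> is paid once forwards and twice for its inverse; the last
      summand is the layer with \<open>decide\<close>.\<close>
    then have "cost w P \<le> 3 * (w i + 2 * (n + 1) * ?T) + w i"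
      by (simp add: P_def cost_append cost_static cost_inverse)
    also have "\<dots> \<le> (6 * n + 10) * ?T" using wi by (simp add: algebra_simps)
    finally show ?thesis .
  qed
  have "run z P 0 = Accept \<and> 0 < D \<or> run z P 0 = Reject \<and> D < 0 \<or> run z P 0 = Go 0 \<and> \<bar>D\<bar> \<le> B / 2"
    if D: "D = real (length (filter z xs)) - \<theta>" "\<bar>D\<bar> \<le> B" "D \<noteq> 0" for z D
  proof -
    let ?N = "length (filter z xs)"
    obtain u where u: "run z (concat (map (stage xs c) [n..<n + (n + 1)])) s0 = Go u"
      "near W u (- a * \<theta> + real ?N * (\<Sum>m\<in>{n..<n + (n + 1)}. real (c m) / real m))
        (1 / real (96 * n) + real (n + 1) / real (96 * n))"
      using run_stages[OF s0 assms(2), of z xs c "n + 1"] unfolding W_def by blast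
    have "{n..<n + (n + 1)} = {n..2 * n}" by auto
    then have eq: "- a * \<theta> + real ?N * (\<Sum>m\<in>{n..<n + (n + 1)}. real (c m) / real m) =
        a * D + of_int (int ?N * q)"
      using c unfolding D(1) by (simp add: algebra_simps)
    \<comment> \<open>One rounding error stems from \<open>s0\<close> and \<open>n + 1\<close> from
      the stages, and \<open>n + 2 \<le> 3 * n\<close>.\<close>
    have "1 / real (96 * n) + real (n + 1) / real (96 * n) \<le> 1 / 32"
      using assms(2) by (simp add: field_simps)
    then have "near W u (a * D + of_int (int ?N * q)) (1 / 32)"
      using near_mono[OF u(2)] unfolding eq by blast
    from near_shift_int[OF this, of "- (int ?N * q)"] have "near W u (a * D) (1 / 32)" by simp
    moreover have "a \<le> 1 / (4 * B)" using a(2) by simp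
    ultimately have dec: "decide W u = Accept \<and> 0 < D \<or> decide W u = Reject \<and> D < 0 \<or>
        decide W u = Go u \<and> \<bar>D\<bar> \<le> B / 2"
      using decide_near assms(3) a(1) D(2,3) by blast
    have F: "run z F 0 = Go u" using u(1) by (simp add: F_def)
    moreover have "run z (inverse_program W F) u = Go 0"
      by (rule run_inverse[OF _ _ F]) (use revF in \<open>auto simp: W_def\<close>)
    ultimately show ?thesis using dec by (auto simp: P_def run_append)
  qed
  then show ?thesis using rev var cost by blast
qed

text \<open>Each level either settles the sign or returns to state 0 with \<open>B\<close> halved.
  After \<open>k\<close> levels the bound is below 1/4, so no admissible \<open>D\<close> is left
  and a constant layer may end the program. Keeping \<open>n\<close> for all levels gives them the
  same width.\<close>

lemma ex_threshold_program:
  fixes B \<theta> :: real and xs :: "'i list"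
  assumes "xs \<noteq> []" "n > 0" "0 < B" "8 * B \<le> 2 ^ n" "B < 2 ^ k / 4"
  defines "W \<equiv> 96 * (n + (n + 1))"
  shows "\<exists>P. P \<noteq> [] \<and> (\<forall>l\<in>set P. reversible_layer W l) \<and> fst ` set P \<subseteq> set xs \<and>
    (\<forall>w. cost w P \<le> (k * (6 * n + 10) + 1) * sum_list (map w xs)) \<and>
    (\<forall>z D. D = real (length (filter z xs)) - \<theta> \<longrightarrow> \<bar>D\<bar> \<le> B \<longrightarrow> 1 / 4 \<le> \<bar>D\<bar> \<longrightarrow>
      run z P 0 = (if 0 < D then Accept else Reject))"
  using assms(3-5)
proof (induction k arbitrary: B)
  case 0
  have "w (hd xs) \<le> sum_list (map w xs)" for w :: "'i \<Rightarrow> nat"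
    using assms(1) by (intro member_le_sum_list) auto
  moreover have "reversible_layer W (static (hd xs) (\<lambda>_. Reject))"
    by (rule reversible_static) auto
  ultimately show ?case using 0 assms(1)
    by (intro exI[of _ "[static (hd xs) (\<lambda>_. Reject)]"]) (auto simp: cost_static cost_def[of _ "[]"])
next
  case (Suc k)
  obtain P where P: "\<forall>l\<in>set P. reversible_layer W l" "fst ` set P \<subseteq> set xs"
    "\<And>w. cost w P \<le> (6 * n + 10) * sum_list (map w xs)"
    "\<And>z D. D = real (length (filter z xs)) - \<theta> \<Longrightarrow> \<bar>D\<bar> \<le> B \<Longrightarrow> D \<noteq> 0 \<Longrightarrow>
      run z P 0 = Accept \<and> 0 < D \<or> run z P 0 = Reject \<and> D < 0 \<or> run z P 0 = Go 0 \<and> \<bar>D\<bar> \<le> B / 2"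
    using ex_level[OF assms(1,2) Suc.prems(1,2), of \<theta>] unfolding W_def by blast
  have "\<exists>Q. Q \<noteq> [] \<and> (\<forall>l\<in>set Q. reversible_layer W l) \<and> fst ` set Q \<subseteq> set xs \<and>
    (\<forall>w. cost w Q \<le> (k * (6 * n + 10) + 1) * sum_list (map w xs)) \<and>
    (\<forall>z D. D = real (length (filter z xs)) - \<theta> \<longrightarrow> \<bar>D\<bar> \<le> B / 2 \<longrightarrow> 1 / 4 \<le> \<bar>D\<bar> \<longrightarrow>
      run z Q 0 = (if 0 < D then Accept else Reject))"
    using Suc.prems by (intro Suc.IH) auto
  then obtain Q where Q: "Q \<noteq> []" "\<forall>l\<in>set Q. reversible_layer W l" "fst ` set Q \<subseteq> set xs"
    "\<And>w. cost w Q \<le> (k * (6 * n + 10) + 1) * sum_list (map w xs)"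
    "\<And>z D. D = real (length (filter z xs)) - \<theta> \<Longrightarrow> \<bar>D\<bar> \<le> B / 2 \<Longrightarrow> 1 / 4 \<le> \<bar>D\<bar> \<Longrightarrow>
      run z Q 0 = (if 0 < D then Accept else Reject)" by blast
  have "cost w (P @ Q) \<le> (Suc k * (6 * n + 10) + 1) * sum_list (map w xs)" for w
    using P(3)[of w] Q(4)[of w] by (simp add: cost_append algebra_simps)
  moreover have "run z (P @ Q) 0 = (if 0 < D then Accept else Reject)"
    if "D = real (length (filter z xs)) - \<theta>" "\<bar>D\<bar> \<le> B" "1 / 4 \<le> \<bar>D\<bar>" for z D
  proof -
    have "D \<noteq> 0" using that(3) by auto
    from P(4)[OF that(1,2) this] Q(5)[OF that(1) _ that(3)] show ?thesis
      by (auto simp: run_append)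
  qed
  ultimately show ?case using P(1,2) Q(1,2,3)
    by (intro exI[of _ "P @ Q"]) (auto simp: image_Un)
qed

section \<open>Composition\<close>

lemma GH_eq_0_I:
  assumes "\<And>x y. x \<in> X \<Longrightarrow> y \<in> Y \<Longrightarrow> \<not> h x y"
  shows "GH X Y h = 0"
proof -
  have "outputs id id (0 :: nat) (h x y)" if "x \<in> X" "y \<in> Y" for x y
    using assms[OF that] walk_0 unfolding outputs_def by fastforce
  then have "GH X Y h \<le> card ({} :: nat set)"
    by (intro GH_le_nat[where t = 0 and a = "\<lambda>_. id" and b = "\<lambda>_. id"]) (auto simp: matching_map_def)
  then show ?thesis by simp
qed

lemma finite_bitstrings: "finite (bitstrings n)"
  using finite_lists_length_eq[of "UNIV :: bool set" n] by (simp add: bitstrings_def)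

lemma nths_in_bitstrings:
  assumes "x \<in> bitstrings a" "S \<subseteq> {..<a}" "card S = n"
  shows "nths x S \<in> bitstrings n"
proof -
  have "{i. i < length x \<and> i \<in> S} = S" using assms by (auto simp: bitstrings_def)
  then show ?thesis using assms by (simp add: bitstrings_def length_nths)
qed

lemma sum_of_bool_eq_length_filter:
  fixes k :: nat
  assumes "distinct xs" "set xs \<subseteq> {1..k}" "\<And>i. i \<in> {1..k} \<Longrightarrow> i \<notin> set xs \<Longrightarrow> \<not> z i"
  shows "(\<Sum>i=1..k. of_bool (z i) :: 'a :: semiring_1) = of_nat (length (filter z xs))"
proof -
  have "(\<Sum>i=1..k. of_bool (z i) :: 'a) = of_nat (card ({1..k} \<inter> {i. z i}))"
    by (simp add: sum_of_bool_eq)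
  also have "{1..k} \<inter> {i. z i} = set (filter z xs)"
    using assms(2,3) unfolding set_filter by blast
  also have "card (set (filter z xs)) = length (filter z xs)"
    using assms(1) by (intro distinct_card) simp
  finally show ?thesis .
qed

text \<open>Arguments of complexity 0 are constantly false. They have to be removed, since a switch has
  at least three pipes even if its function is computed without any.\<close>

lemma GH_compose_le:
  assumes parts: "input_parts k n a b A B" and W: "0 < W"
    and prog: "\<And>xs. distinct xs \<Longrightarrow> set xs \<subseteq> {1..k} \<Longrightarrow> xs \<noteq> [] \<Longrightarrow>
      \<exists>P. P \<noteq> [] \<and> (\<forall>l\<in>set P. reversible_layer W l) \<and> fst ` set P \<subseteq> set xs \<and>
        (\<forall>w. cost w P \<le> K * sum_list (map w xs)) \<and>
        (\<forall>z. (\<forall>i\<in>{1..k}. i \<notin> set xs \<longrightarrow> \<not> z i) \<longrightarrow> run z P 0 = (if H z then Accept else Reject))"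
    and false: "\<And>z. (\<And>i. i \<in> {1..k} \<Longrightarrow> \<not> z i) \<Longrightarrow> \<not> H z"
  shows "GH (bitstrings a) (bitstrings b) (\<lambda>x y. H (\<lambda>i. on_parts f A B i x y))
    \<le> 18 * W * K * (\<Sum>i=1..k. GH (bitstrings n) (bitstrings n) (f i))"
proof -
  define w where "w i = GH (bitstrings n) (bitstrings n) (f i)" for i
  define xs where "xs = filter (\<lambda>i. 0 < w i) [1..<Suc k]"
  have inA: "nths x (A i) \<in> bitstrings n" if "i \<in> {1..k}" "x \<in> bitstrings a" for i x
    using parts that by (intro nths_in_bitstrings[of x a]) (auto simp: input_parts_def)
  have inB: "nths y (B i) \<in> bitstrings n" if "i \<in> {1..k}" "y \<in> bitstrings b" for i y
    using parts that by (intro nths_in_bitstrings[of y b]) (auto simp: input_parts_def)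
  have xs: "distinct xs" "set xs \<subseteq> {1..k}" by (auto simp: xs_def)
  have zero: "\<not> on_parts f A B i x y"
    if "i \<in> {1..k}" "i \<notin> set xs" "x \<in> bitstrings a" "y \<in> bitstrings b" for i x y
  proof -
    have "w i = 0" using that by (auto simp: xs_def simp del: upt_Suc)
    then show ?thesis unfolding on_parts_def w_def
      by (intro GH_eq_0_D[OF finite_bitstrings, of n "bitstrings n" "f i"] inA inB that(1,3,4))
  qed
  have sum: "sum_list (map w xs) = (\<Sum>i=1..k. w i)"
  proof -
    have "sum_list (map w xs) = sum_list (map w [1..<Suc k])"
      unfolding xs_def by (rule sum_list_map_filter) simp
    also have "\<dots> = sum w (set [1..<Suc k])" by (rule interv_sum_list_conv_sum_set_nat)
    also have "set [1..<Suc k] = {1..k}" by auto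
    finally show ?thesis .
  qed
  show ?thesis
  proof (cases "xs = []")
    \<comment> \<open>All arguments are constantly false, hence so is the composition by the
      assumption on \<open>H\<close>, and no pipes are required.\<close>
    case True
    then have "\<not> H (\<lambda>i. on_parts f A B i x y)" if "x \<in> bitstrings a" "y \<in> bitstrings b" for x y
      using zero that by (intro false) auto
    then have "GH (bitstrings a) (bitstrings b) (\<lambda>x y. H (\<lambda>i. on_parts f A B i x y)) = 0"
      by (rule GH_eq_0_I)
    then show ?thesis by simp
  next
    case False
    obtain P where P: "P \<noteq> []" "\<forall>l\<in>set P. reversible_layer W l" "fst ` set P \<subseteq> set xs"
      "\<forall>w. cost w P \<le> K * sum_list (map w xs)"
      "\<forall>z. (\<forall>i\<in>{1..k}. i \<notin> set xs \<longrightarrow> \<not> z i) \<longrightarrow> run z P 0 = (if H z then Accept else Reject)"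
      using prog[OF xs False] by (elim exE conjE) (rule that)
    have "GH (bitstrings a) (bitstrings b) (\<lambda>x y. H (\<lambda>i. on_parts f A B i x y)) \<le> 18 * W * cost w P"
      unfolding w_def
    proof (rule GH_le_program[where I = "{1..k}" and g = "\<lambda>i x. nths x (A i)" and h = "\<lambda>i y. nths y (B i)"])
      show "fst ` set P \<subseteq> {1..k}" using P(3) xs by blast
      show "0 < GH (bitstrings n) (bitstrings n) (f i)" if "i \<in> fst ` set P" for i
        using subsetD[OF P(3) that] by (simp add: xs_def w_def)
      show "run (\<lambda>i. f i (nths x (A i)) (nths y (B i))) P 0 =
          (if H (\<lambda>i. on_parts f A B i x y) then Accept else Reject)"
        if "x \<in> bitstrings a" "y \<in> bitstrings b" for x y
        using P(5)[rule_format, of "\<lambda>i. on_parts f A B i x y"] zero that by (simp add: on_parts_def)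
    qed (use finite_bitstrings inA inB P W in auto)
    also have "\<dots> \<le> 18 * W * (K * (\<Sum>i=1..k. w i))"
      using P(4)[rule_format, of w] sum by (intro mult_left_mono) auto
    finally show ?thesis by (simp add: w_def mult.assoc)
  qed
qed

lemma hd_le_sum_list: "xs \<noteq> [] \<Longrightarrow> w (hd xs) \<le> sum_list (map w xs)" for w :: "'i \<Rightarrow> nat"
  by (intro member_le_sum_list) auto

section \<open>Programs for disjunction, conjunction, parity and majority\<close>

text \<open>State 0 means that no true variable has been met. A true one leads to state 1, which
  accepts at once, so only one state survives each layer and nothing is merged.\<close>

lemma ex_OR_program:
  assumes "set xs \<subseteq> {1..k}" "xs \<noteq> []"
  shows "\<exists>P. P \<noteq> [] \<and> (\<forall>l\<in>set P. reversible_layer 2 l) \<and> fst ` set P \<subseteq> set xs \<and>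
    (\<forall>w. cost w P \<le> 2 * sum_list (map w xs)) \<and>
    (\<forall>z. (\<forall>i\<in>{1..k}. i \<notin> set xs \<longrightarrow> \<not> z i) \<longrightarrow> run z P 0 = (if OR k z then Accept else Reject))"
proof -
  define e where "e s = (if s = 0 then Go 0 else Accept)" for s :: nat
  define Q where "Q ys = map (\<lambda>i. (i, cyclic_shift 2 1, e)) ys" for ys :: "nat list"
  have r: "reversible_layer 2 (i, cyclic_shift 2 1, e)" for i
    by (rule reversible_layerI) (auto simp: e_def cyclic_shift_permutes split: if_splits)
  have r': "reversible_layer 2 (static (hd xs) (\<lambda>_. Reject))" by (rule reversible_static) auto
  have run: "run z (Q ys) 0 = (if \<exists>i\<in>set ys. z i then Accept else Go 0)" for z ys
    by (induction ys) (auto simp: Q_def e_def cyclic_shift_def)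
  have "cost w (Q xs @ [static (hd xs) (\<lambda>_. Reject)]) \<le> 2 * sum_list (map w xs)" for w
    using hd_le_sum_list[OF assms(2), of w]
    by (simp add: Q_def cost_append cost_map cost_static cost_def[of _ "[]"])
  moreover have "OR k z \<longleftrightarrow> (\<exists>i\<in>set xs. z i)" if "\<forall>i\<in>{1..k}. i \<notin> set xs \<longrightarrow> \<not> z i" for z
    using that assms by (auto simp: OR_def)
  ultimately show ?thesis
    using assms(2) r r' by (intro exI[of _ "Q xs @ [static (hd xs) (\<lambda>_. Reject)]"])
      (auto simp: run_append run, auto simp: Q_def)
qed

lemma ex_AND_program:
  assumes "set xs \<subseteq> {1..k}" "xs \<noteq> []"
  shows "\<exists>P. P \<noteq> [] \<and> (\<forall>l\<in>set P. reversible_layer 2 l) \<and> fst ` set P \<subseteq> set xs \<and>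
    (\<forall>w. cost w P \<le> 2 * sum_list (map w xs)) \<and>
    (\<forall>z. (\<forall>i\<in>{1..k}. i \<notin> set xs \<longrightarrow> \<not> z i) \<longrightarrow> run z P 0 = (if AND k z then Accept else Reject))"
proof -
  define e where "e s = (if s = 0 then Reject else Go 0)" for s :: nat
  define Q where "Q ys = map (\<lambda>i. (i, cyclic_shift 2 1, e)) ys" for ys :: "nat list"
  \<comment> \<open>An index missing in \<open>xs\<close> belongs to a false variable, which makes
    the conjunction false.\<close>
  define o' where "o' = (if set xs = {1..k} then Accept else Reject)"
  have o': "o' \<noteq> Go u" for u by (simp add: o'_def)
  have r: "reversible_layer 2 (i, cyclic_shift 2 1, e)" for i
    by (rule reversible_layerI) (auto simp: e_def cyclic_shift_permutes split: if_splits)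
  have r': "reversible_layer 2 (static (hd xs) (\<lambda>_. o'))" by (rule reversible_static) (auto simp: o')
  have run: "run z (Q ys) 0 = (if \<forall>i\<in>set ys. z i then Go 0 else Reject)" for z ys
    by (induction ys) (auto simp: Q_def e_def cyclic_shift_def)
  have "cost w (Q xs @ [static (hd xs) (\<lambda>_. o')]) \<le> 2 * sum_list (map w xs)" for w
    using hd_le_sum_list[OF assms(2), of w]
    by (simp add: Q_def cost_append cost_map cost_static cost_def[of _ "[]"])
  moreover have "AND k z \<longleftrightarrow> (\<forall>i\<in>set xs. z i) \<and> set xs = {1..k}"
    if "\<forall>i\<in>{1..k}. i \<notin> set xs \<longrightarrow> \<not> z i" for z
    using that assms by (auto simp: AND_def)
  ultimately show ?thesis
    using assms(2) r r' by (intro exI[of _ "Q xs @ [static (hd xs) (\<lambda>_. o')]"])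
      (auto simp: run_append run o'_def, auto simp: Q_def)
qed

lemma ex_XOR_program:
  assumes "distinct xs" "set xs \<subseteq> {1..k}" "xs \<noteq> []"
  shows "\<exists>P. P \<noteq> [] \<and> (\<forall>l\<in>set P. reversible_layer 2 l) \<and> fst ` set P \<subseteq> set xs \<and>
    (\<forall>w. cost w P \<le> 2 * sum_list (map w xs)) \<and>
    (\<forall>z. (\<forall>i\<in>{1..k}. i \<notin> set xs \<longrightarrow> \<not> z i) \<longrightarrow> run z P 0 = (if XOR k z then Accept else Reject))"
proof -
  define e where "e s = (if s = 0 then Reject else Accept)" for s :: nat
  let ?P = "counter 2 1 xs @ [static (hd xs) e]"
  have r': "reversible_layer 2 (static (hd xs) e)" by (rule reversible_static) (auto simp: e_def split: if_splits)
  have "cost w ?P \<le> 2 * sum_list (map w xs)" for w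
    using hd_le_sum_list[OF assms(3), of w]
    by (simp add: cost_append cost_counter cost_static cost_def[of _ "[]"])
  moreover have "run z ?P 0 = (if XOR k z then Accept else Reject)"
    if "\<forall>i\<in>{1..k}. i \<notin> set xs \<longrightarrow> \<not> z i" for z
    using sum_of_bool_eq_length_filter[OF assms(1,2), of z, where 'a = nat] that
    by (auto simp: run_append run_counter XOR_def e_def odd_iff_mod_2_eq_one)
  moreover have "\<forall>l\<in>set ?P. reversible_layer 2 l"
    using r' reversible_counter[of 2 2] by auto
  moreover have "fst ` set ?P \<subseteq> set xs" using assms(3) by (auto simp: counter_def)
  ultimately show ?thesis by blast
qed

text \<open>Lowering the threshold \<open>k / 2\<close> by 1/4 keeps \<open>D\<close> away from 0:
  it is at least 1/4 if at least half of the variables are true and at most -1/4 otherwise. The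
  first bound on its absolute value is \<open>k\<close>, so \<open>m\<close> levels suffice.\<close>

lemma ex_MAJ_program:
  assumes "distinct xs" "set xs \<subseteq> {1..k}" "xs \<noteq> []" "0 < m" "8 * real k \<le> 2 ^ m"
  shows "\<exists>P. P \<noteq> [] \<and> (\<forall>l\<in>set P. reversible_layer (96 * (m + (m + 1))) l) \<and> fst ` set P \<subseteq> set xs \<and>
    (\<forall>w. cost w P \<le> (m * (6 * m + 10) + 1) * sum_list (map w xs)) \<and>
    (\<forall>z. (\<forall>i\<in>{1..k}. i \<notin> set xs \<longrightarrow> \<not> z i) \<longrightarrow> run z P 0 = (if MAJ k z then Accept else Reject))"
proof -
  have k: "0 < k" using assms(2,3) by (cases k) auto
  then have k': "0 < real k" "real k < 2 ^ m / 4" using assms(5) by auto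
  obtain P where P: "P \<noteq> []" "\<forall>l\<in>set P. reversible_layer (96 * (m + (m + 1))) l" "fst ` set P \<subseteq> set xs"
    "\<And>w. cost w P \<le> (m * (6 * m + 10) + 1) * sum_list (map w xs)"
    "\<And>z D. D = real (length (filter z xs)) - (real k / 2 - 1 / 4) \<Longrightarrow> \<bar>D\<bar> \<le> real k \<Longrightarrow> 1 / 4 \<le> \<bar>D\<bar> \<Longrightarrow>
      run z P 0 = (if 0 < D then Accept else Reject)"
    using ex_threshold_program[OF assms(3,4) k'(1) assms(5) k'(2), of "real k / 2 - 1 / 4"] by blast
  have "run z P 0 = (if MAJ k z then Accept else Reject)"
    if "\<forall>i\<in>{1..k}. i \<notin> set xs \<longrightarrow> \<not> z i" for z
  proof -
    let ?N = "length (filter z xs)"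
    have "length xs \<le> k"
      using card_mono[of "{1..k}" "set xs"] assms(1,2) by (simp add: distinct_card)
    then have "?N \<le> k" using length_filter_le[of z xs] by linarith
    moreover have "2 * ?N \<ge> k \<or> 2 * ?N + 1 \<le> k" by linarith
    then have "2 * real ?N \<ge> real k \<or> 2 * real ?N + 1 \<le> real k" by linarith
    moreover have "MAJ k z \<longleftrightarrow> real k / 2 \<le> real ?N"
      using sum_of_bool_eq_length_filter[OF assms(1,2), of z, where 'a = real] that by (simp add: MAJ_def)
    moreover have "1 \<le> real k" using k by simp
    ultimately show ?thesis using P(5)[OF refl, of z] by (auto simp: abs_if split: if_splits)
  qed
  then show ?thesis using P(1-4) by blast
qed

section \<open>Constants and final bounds\<close>

lemma ex_log_exponent:
  assumes "k \<ge> 2"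
  shows "\<exists>m. 0 < m \<and> 8 * real k \<le> 2 ^ m \<and> real m \<le> 5 * log 2 (real k)"
proof -
  \<comment> \<open>The summand 3 provides the factor 8.\<close>
  define m where "m = nat \<lceil>log 2 (real k)\<rceil> + 3"
  have l: "1 \<le> log 2 (real k)" using assms by simp
  then have m: "log 2 (real k) \<le> real m - 3" "real m - 3 \<le> log 2 (real k) + 1"
    unfolding m_def by linarith+
  have "real k = 2 powr log 2 (real k)" using assms by simp
  also have "\<dots> \<le> 2 powr (real m - 3)" using m(1) by simp
  also have "\<dots> = 2 ^ m / 8" by (simp add: powr_diff powr_realpow)
  finally have "8 * real k \<le> 2 ^ m" by simp
  \<comment> \<open>\<open>m\<close> is at most the logarithm plus 4, and the logarithm is at least
    1 because \<open>k \<ge> 2\<close>.\<close>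
  moreover have "real m \<le> 5 * log 2 (real k)" using m l by linarith
  moreover have "0 < m" by (simp add: m_def)
  ultimately show ?thesis by blast
qed

text \<open>The width is at most \<open>288 * m\<close> and the cost factor at most
  \<open>17 * m ^ 2\<close>; the constant is 18 * 288 * 17 * 5 ^ 3.\<close>

lemma MAJ_cost_le:
  assumes "real m \<le> 5 * l" "0 < m"
  shows "real (18 * (96 * (m + (m + 1))) * (m * (6 * m + 10) + 1)) \<le> 11016000 * l ^ 3"
proof -
  have "m + (m + 1) \<le> 3 * m" "m * (6 * m + 10) + 1 \<le> 17 * (m * m)"
    using assms(2) by (auto simp: algebra_simps Suc_le_eq) 
  then have "18 * (96 * (m + (m + 1))) * (m * (6 * m + 10) + 1) \<le> 18 * (96 * (3 * m)) * (17 * (m * m))"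
    by (intro mult_le_mono) auto
  also have "\<dots> = 88128 * m ^ 3" by (simp add: power3_eq_cube)
  finally have "real (18 * (96 * (m + (m + 1))) * (m * (6 * m + 10) + 1)) \<le> real (88128 * m ^ 3)"
    by (rule of_nat_mono)
  also have "\<dots> = 88128 * real m ^ 3" by simp
  also have "\<dots> \<le> 88128 * (5 * l) ^ 3" using assms(1) by (intro mult_left_mono power_mono) auto
  finally show ?thesis by (simp add: power_mult_distrib)
qed

lemma GH_compose_linear:
  assumes prog: "\<And>k xs. distinct xs \<Longrightarrow> set xs \<subseteq> {1..k} \<Longrightarrow> xs \<noteq> [] \<Longrightarrow>
      \<exists>P. P \<noteq> [] \<and> (\<forall>l\<in>set P. reversible_layer 2 l) \<and> fst ` set P \<subseteq> set xs \<and>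
        (\<forall>w. cost w P \<le> 2 * sum_list (map w xs)) \<and>
        (\<forall>z. (\<forall>i\<in>{1..k}. i \<notin> set xs \<longrightarrow> \<not> z i) \<longrightarrow> run z P 0 = (if H k z then Accept else Reject))"
    and false: "\<And>k z. k \<ge> 1 \<Longrightarrow> (\<And>i. i \<in> {1..k} \<Longrightarrow> \<not> z i) \<Longrightarrow> \<not> H k z"
  shows "\<exists>C::real. \<forall>k n a b f A B. k \<ge> 1 \<and> input_parts k n a b A B \<longrightarrow>
      real (GH (bitstrings a) (bitstrings b) (\<lambda>x y. H k (\<lambda>i. on_parts f A B i x y)))
        \<le> C * (\<Sum>i=1..k. real (GH (bitstrings n) (bitstrings n) (f i)))"
\<comment> \<open>72 = 18 * 2 * 2, from width 2 and cost factor 2.\<close>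
proof (intro exI[of _ 72] allI impI, elim conjE)
  fix k n a b :: nat and f A B
  assume k: "k \<ge> 1" and parts: "input_parts k n a b A B"
  have "GH (bitstrings a) (bitstrings b) (\<lambda>x y. H k (\<lambda>i. on_parts f A B i x y))
      \<le> 18 * 2 * 2 * (\<Sum>i=1..k. GH (bitstrings n) (bitstrings n) (f i))"
    by (rule GH_compose_le[OF parts _ prog false[OF k]]) simp_all
  from of_nat_mono[OF this, where 'a = real]
  show "real (GH (bitstrings a) (bitstrings b) (\<lambda>x y. H k (\<lambda>i. on_parts f A B i x y)))
      \<le> 72 * (\<Sum>i=1..k. real (GH (bitstrings n) (bitstrings n) (f i)))" by simp
qed

theorem theorem3:
  shows "(\<exists>C::real. \<forall>k n a b f A B. k \<ge> 1 \<and> input_parts k n a b A B \<longrightarrow>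
            real (GH (bitstrings a) (bitstrings b) (\<lambda>x y. OR k (\<lambda>i. on_parts f A B i x y)))
              \<le> C * (\<Sum>i=1..k. real (GH (bitstrings n) (bitstrings n) (f i))))
       \<and> (\<exists>C::real. \<forall>k n a b f A B. k \<ge> 1 \<and> input_parts k n a b A B \<longrightarrow>
            real (GH (bitstrings a) (bitstrings b) (\<lambda>x y. AND k (\<lambda>i. on_parts f A B i x y)))
              \<le> C * (\<Sum>i=1..k. real (GH (bitstrings n) (bitstrings n) (f i))))
       \<and> (\<exists>C::real. \<forall>k n a b f A B. k \<ge> 1 \<and> input_parts k n a b A B \<longrightarrow>
            real (GH (bitstrings a) (bitstrings b) (\<lambda>x y. XOR k (\<lambda>i. on_parts f A B i x y)))
              \<le> C * (\<Sum>i=1..k. real (GH (bitstrings n) (bitstrings n) (f i))))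
       \<and> (\<exists>C::real. \<forall>k n a b f A B. k \<ge> 2 \<and> input_parts k n a b A B \<longrightarrow>
            real (GH (bitstrings a) (bitstrings b) (\<lambda>x y. MAJ k (\<lambda>i. on_parts f A B i x y)))
              \<le> C * ((\<Sum>i=1..k. real (GH (bitstrings n) (bitstrings n) (f i))) * log 2 (real k) ^ 3))"
proof (intro conjI)
  show "\<exists>C::real. \<forall>k n a b f A B. k \<ge> 1 \<and> input_parts k n a b A B \<longrightarrow>
      real (GH (bitstrings a) (bitstrings b) (\<lambda>x y. OR k (\<lambda>i. on_parts f A B i x y)))
        \<le> C * (\<Sum>i=1..k. real (GH (bitstrings n) (bitstrings n) (f i)))"
  proof (rule GH_compose_linear[of OR])
    show "\<not> OR k z" if "k \<ge> 1" "\<And>i. i \<in> {1..k} \<Longrightarrow> \<not> z i" for k z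
      using that by (auto simp: OR_def)
  qed (rule ex_OR_program)
  show "\<exists>C::real. \<forall>k n a b f A B. k \<ge> 1 \<and> input_parts k n a b A B \<longrightarrow>
      real (GH (bitstrings a) (bitstrings b) (\<lambda>x y. AND k (\<lambda>i. on_parts f A B i x y)))
        \<le> C * (\<Sum>i=1..k. real (GH (bitstrings n) (bitstrings n) (f i)))"
  proof (rule GH_compose_linear[of AND])
    \<comment> \<open>This relies on \<open>k \<ge> 1\<close>, the empty conjunction being
      true.\<close>
    show "\<not> AND k z" if "k \<ge> 1" "\<And>i. i \<in> {1..k} \<Longrightarrow> \<not> z i" for k z
      using that by (auto simp: AND_def)
  qed (rule ex_AND_program)
  show "\<exists>C::real. \<forall>k n a b f A B. k \<ge> 1 \<and> input_parts k n a b A B \<longrightarrow>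
      real (GH (bitstrings a) (bitstrings b) (\<lambda>x y. XOR k (\<lambda>i. on_parts f A B i x y)))
        \<le> C * (\<Sum>i=1..k. real (GH (bitstrings n) (bitstrings n) (f i)))"
  proof (rule GH_compose_linear[of XOR])
    show "\<not> XOR k z" if "k \<ge> 1" "\<And>i. i \<in> {1..k} \<Longrightarrow> \<not> z i" for k z
      using that by (auto simp: XOR_def)
  qed (rule ex_XOR_program)
  show "\<exists>C::real. \<forall>k n a b f A B. k \<ge> 2 \<and> input_parts k n a b A B \<longrightarrow>
      real (GH (bitstrings a) (bitstrings b) (\<lambda>x y. MAJ k (\<lambda>i. on_parts f A B i x y)))
        \<le> C * ((\<Sum>i=1..k. real (GH (bitstrings n) (bitstrings n) (f i))) * log 2 (real k) ^ 3)"
  proof (intro exI[of _ 11016000] allI impI, elim conjE)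
    fix k n a b :: nat and f A B
    assume k: "k \<ge> 2" and parts: "input_parts k n a b A B"
    obtain m where m: "0 < m" "8 * real k \<le> 2 ^ m" "real m \<le> 5 * log 2 (real k)"
      using ex_log_exponent[OF k] by blast
    let ?W = "96 * (m + (m + 1))" and ?K = "m * (6 * m + 10) + 1"
    let ?S = "\<Sum>i=1..k. real (GH (bitstrings n) (bitstrings n) (f i))"
    have "GH (bitstrings a) (bitstrings b) (\<lambda>x y. MAJ k (\<lambda>i. on_parts f A B i x y))
        \<le> 18 * ?W * ?K * (\<Sum>i=1..k. GH (bitstrings n) (bitstrings n) (f i))"
    proof (rule GH_compose_le[OF parts])
      show "\<not> MAJ k z" if "\<And>i. i \<in> {1..k} \<Longrightarrow> \<not> z i" for z
        using that k by (simp add: MAJ_def)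
    qed (use ex_MAJ_program[OF _ _ _ m(1,2)] in auto)
    then have "real (GH (bitstrings a) (bitstrings b) (\<lambda>x y. MAJ k (\<lambda>i. on_parts f A B i x y)))
        \<le> real (18 * ?W * ?K) * ?S"
      using of_nat_mono[where 'a = real] by fastforce
    also have "\<dots> \<le> (11016000 * log 2 (real k) ^ 3) * ?S"
      using MAJ_cost_le[OF m(3,1)] by (rule mult_right_mono) (simp add: sum_nonneg)
    finally show "real (GH (bitstrings a) (bitstrings b) (\<lambda>x y. MAJ k (\<lambda>i. on_parts f A B i x y)))
        \<le> 11016000 * (?S * log 2 (real k) ^ 3)"
      by (simp add: mult_ac)
  qed
qed

end
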